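(* Let $\mathfrak{C}=\left(\begin{matrix} P_{-1} & \subset & P_0\\ \cup & & \cup\\ Q_{-1} & \subset & Q_0\end{matrix},\tau\right)$ be a commuting square of finite dimensional von Neumann algebras, and assume there exist hermitian elements $p_0\in Q_{-1}'\cap P_{-1}$ and $q_0\in Q_{-1}'\cap Q_0$, neither of which lies in $Q_{-1}$, such that $p_0q_0-q_0p_0=0$. For $t\in\mathbb{R}$ let $U_t=\exp(itp_0q_0)$. Then $$\mathfrak{C}_t=\left(\begin{matrix} P_{-1} & \subset & P_0\\ \cup & & \cup\\ Q_{-1} & \subset & U_t^*Q_0U_t\end{matrix},\tau\right),\qquad t\in\mathbb{R},$$ is a one-parameter family of commuting squares, i.e. $\mathfrak{C}_t$ is a commuting square for every $t\in\mathbb{R}$.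
   Context: Commuting square: a square of (unital) inclusions of finite dimensional von Neumann algebras $Q_{-1}\subset P_{-1}\subset P_0$, $Q_{-1}\subset Q_0\subset P_0$ together with a faithful positive trace $\tau$ on $P_0$, $\tau(1)=1$, such that $E_{P_{-1}}E_{Q_0}=E_{Q_{-1}}$, where $E_A$ denotes the $\tau$-preserving conditional expectation of $P_0$ onto the subalgebra $A\subset P_0$. Notation: $B'\cap A=\{a\in A: ab=ba\ \forall b\in B\}$. *)

theory Defs
  imports "HOL-Analysis.Analysis"
begin

section \<open>Complex Hilbert spaces\<close>

class complex_vector = real_vector +
  fixes scaleC :: "complex \<Rightarrow> 'a \<Rightarrow> 'a" (infixr \<open>*\<^sub>C\<close> 75)
  assumes scaleC_add_right: "c *\<^sub>C (x + y) = c *\<^sub>C x + c *\<^sub>C y"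
    and scaleC_add_left: "(c + d) *\<^sub>C x = c *\<^sub>C x + d *\<^sub>C x"
    and scaleC_scaleC: "c *\<^sub>C (d *\<^sub>C x) = (c * d) *\<^sub>C x"
    and scaleC_of_real: "complex_of_real r *\<^sub>C x = r *\<^sub>R x"

global_interpretation complex_vector: vector_space "scaleC :: complex \<Rightarrow> 'a \<Rightarrow> 'a::complex_vector"
  defines complex_span = complex_vector.span
  by standard
    (use scaleC_of_real[of 1] in
      \<open>simp_all add: scaleC_add_right scaleC_add_left scaleC_scaleC\<close>)

text \<open>The inner product is linear in its first argument.  Besides completeness the class asks for a
  nonzero vector: this gives norm 1 = 1 for operators, hence access to the library's \<^const>\<open>exp\<close>.
  The zero space carries no trace with value 1 at the identity.\<close>

class complex_hilbert_space = complex_vector + banach +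
  fixes cinner :: "'a \<Rightarrow> 'a \<Rightarrow> complex"
  assumes cinner_commute: "cinner x y = cnj (cinner y x)"
    and cinner_add_left: "cinner (x + y) z = cinner x z + cinner y z"
    and cinner_scaleC_left: "cinner (c *\<^sub>C x) y = c * cinner x y"
    and cinner_self: "cinner x x = complex_of_real ((norm x)\<^sup>2)"
    and nontrivial: "\<exists>x. x \<noteq> 0"

instantiation complex :: complex_hilbert_space
begin

definition scaleC_complex :: "complex \<Rightarrow> complex \<Rightarrow> complex"
  where "scaleC_complex c x = c * x"

definition cinner_complex :: "complex \<Rightarrow> complex \<Rightarrow> complex"
  where "cinner_complex x y = x * cnj y"

instance
  by standard
    (auto simp: scaleC_complex_def cinner_complex_def algebra_simps scaleR_conv_of_real
      complex_norm_square[symmetric] intro: exI[of _ 1])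

end

instantiation vec :: (complex_hilbert_space, finite) complex_hilbert_space
begin

definition scaleC_vec :: "complex \<Rightarrow> 'a ^ 'b \<Rightarrow> 'a ^ 'b"
  where "scaleC_vec c x = (\<chi> i. c *\<^sub>C (x $ i))"

definition cinner_vec :: "'a ^ 'b \<Rightarrow> 'a ^ 'b \<Rightarrow> complex"
  where "cinner_vec x y = (\<Sum>i\<in>UNIV. cinner (x $ i) (y $ i))"

instance
proof
  fix c d :: complex and r :: real and x y z :: "'a ^ 'b"
  show "c *\<^sub>C (x + y) = c *\<^sub>C x + c *\<^sub>C y"
    and "(c + d) *\<^sub>C x = c *\<^sub>C x + d *\<^sub>C x"
    and "c *\<^sub>C (d *\<^sub>C x) = (c * d) *\<^sub>C x"
    and "complex_of_real r *\<^sub>C x = r *\<^sub>R x"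
    by (simp_all add: vec_eq_iff scaleC_vec_def scaleC_add_right scaleC_add_left
        scaleC_scaleC scaleC_of_real)
  show "cinner x y = cnj (cinner y x)"
    unfolding cinner_vec_def cnj_sum by (rule sum.cong[OF refl]) (rule cinner_commute)
  show "cinner (x + y) z = cinner x z + cinner y z"
    by (simp add: cinner_vec_def cinner_add_left sum.distrib)
  show "cinner (c *\<^sub>C x) y = c * cinner x y"
    by (simp add: cinner_vec_def scaleC_vec_def cinner_scaleC_left sum_distrib_left)
  show "cinner x x = complex_of_real ((norm x)\<^sup>2)"
    by (simp add: cinner_vec_def cinner_self norm_vec_def L2_set_def sum_nonneg)
  obtain u :: 'a where "u \<noteq> 0" using nontrivial by blast
  then have "(\<chi> i. u) \<noteq> (0 :: 'a ^ 'b)" by (simp add: vec_eq_iff)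
  then show "\<exists>x :: 'a ^ 'b. x \<noteq> 0" by blast
qed

end


section \<open>The algebra B(H) of bounded complex-linear operators\<close>

typedef (overloaded) ('h::complex_hilbert_space) bounded_op =
  "{T :: 'h \<Rightarrow>\<^sub>L 'h. \<forall>c x. blinfun_apply T (c *\<^sub>C x) = c *\<^sub>C blinfun_apply T x}"
  morphisms blinfun_of_op Op
  by (rule exI[of _ 0]) simp

setup_lifting type_definition_bounded_op

lift_definition op_apply :: "'h::complex_hilbert_space bounded_op \<Rightarrow> 'h \<Rightarrow> 'h"
  is "\<lambda>T. blinfun_apply T" .

lemma scaleC_scaleR_commute:
  fixes x :: "'a::complex_vector"
  shows "c *\<^sub>C (r *\<^sub>R x) = r *\<^sub>R (c *\<^sub>C x)"
  by (metis scaleC_of_real scaleC_scaleC mult.commute)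

lemma norm_scaleC:
  fixes x :: "'h::complex_hilbert_space"
  shows "norm (c *\<^sub>C x) = cmod c * norm x"
proof -
  have "complex_of_real ((norm (c *\<^sub>C x))\<^sup>2) = c * cnj (c * cinner x x)"
    by (metis cinner_self cinner_scaleC_left cinner_commute)
  also have "\<dots> = complex_of_real ((cmod c * norm x)\<^sup>2)"
    using complex_norm_square[of c] by (simp add: cinner_self power_mult_distrib)
  finally show ?thesis
    by (metis of_real_eq_iff norm_ge_zero mult_nonneg_nonneg power2_eq_iff_nonneg)
qed

lemma bounded_linear_scaleC:
  "bounded_linear (\<lambda>x :: 'h::complex_hilbert_space. c *\<^sub>C x)"
  by (rule bounded_linear_intro[where K = "cmod c"])
    (simp_all add: scaleC_add_right scaleC_scaleR_commute norm_scaleC mult.commute)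

lift_definition blinfun_scaleC ::
  "complex \<Rightarrow> ('h::complex_hilbert_space \<Rightarrow>\<^sub>L 'h) \<Rightarrow> ('h \<Rightarrow>\<^sub>L 'h)"
  is "\<lambda>c T x. c *\<^sub>C T x"
  by (rule bounded_linear_compose[OF bounded_linear_scaleC])

instantiation bounded_op :: (complex_hilbert_space) real_normed_vector
begin

lift_definition norm_bounded_op :: "'a bounded_op \<Rightarrow> real" is norm .

lift_definition zero_bounded_op :: "'a bounded_op" is 0
  by simp

lift_definition plus_bounded_op :: "'a bounded_op \<Rightarrow> 'a bounded_op \<Rightarrow> 'a bounded_op" is "(+)"
  by (simp add: blinfun.add_left scaleC_add_right)

lift_definition minus_bounded_op :: "'a bounded_op \<Rightarrow> 'a bounded_op \<Rightarrow> 'a bounded_op" is "(-)"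
  by (simp add: blinfun.diff_left complex_vector.scale_right_diff_distrib)

lift_definition uminus_bounded_op :: "'a bounded_op \<Rightarrow> 'a bounded_op" is uminus
  by (simp add: blinfun.minus_left)

lift_definition scaleR_bounded_op :: "real \<Rightarrow> 'a bounded_op \<Rightarrow> 'a bounded_op" is "(*\<^sub>R)"
  by (simp add: blinfun.scaleR_left scaleC_scaleR_commute)

definition dist_bounded_op :: "'a bounded_op \<Rightarrow> 'a bounded_op \<Rightarrow> real"
  where "dist_bounded_op S T = norm (S - T)"

definition uniformity_bounded_op :: "('a bounded_op \<times> 'a bounded_op) filter"
  where "uniformity_bounded_op = (INF e\<in>{0<..}. principal {(S, T). dist S T < e})"

definition open_bounded_op :: "'a bounded_op set \<Rightarrow> bool"
  where "open_bounded_op X = (\<forall>S\<in>X. \<forall>\<^sub>F (S', T) in uniformity. S' = S \<longrightarrow> T \<in> X)"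

definition sgn_bounded_op :: "'a bounded_op \<Rightarrow> 'a bounded_op"
  where "sgn_bounded_op T = inverse (norm T) *\<^sub>R T"

instance
  by standard
    (unfold dist_bounded_op_def open_bounded_op_def sgn_bounded_op_def uniformity_bounded_op_def,
      (rule refl | (transfer, simp add: algebra_simps norm_triangle_ineq))+)

end

instantiation bounded_op :: (complex_hilbert_space) complex_vector
begin

lift_definition scaleC_bounded_op :: "complex \<Rightarrow> 'a bounded_op \<Rightarrow> 'a bounded_op"
  is blinfun_scaleC
  by (simp add: blinfun_scaleC.rep_eq scaleC_scaleC mult.commute)

instance
  by standard
    (transfer, rule blinfun_eqI,
      simp add: blinfun_scaleC.rep_eq blinfun.bilinear_simps scaleC_add_right scaleC_add_left
        scaleC_scaleC scaleC_of_real)+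

end

instantiation bounded_op :: (complex_hilbert_space) real_normed_algebra_1
begin

lift_definition one_bounded_op :: "'a bounded_op" is id_blinfun
  by simp

lift_definition times_bounded_op :: "'a bounded_op \<Rightarrow> 'a bounded_op \<Rightarrow> 'a bounded_op"
  is "(o\<^sub>L)"
  by simp

instance
proof
  fix R S T :: "'a bounded_op" and r :: real
  show "R * S * T = R * (S * T)"
    and "(R + S) * T = R * T + S * T"
    and "R * (S + T) = R * S + R * T"
    and "(r *\<^sub>R S) * T = r *\<^sub>R (S * T)"
    and "S * (r *\<^sub>R T) = r *\<^sub>R (S * T)"
    and "1 * T = T"
    and "T * 1 = T"
    by (transfer, rule blinfun_eqI, simp add: blinfun.bilinear_simps)+
  show "norm (S * T) \<le> norm S * norm T"
    by transfer (rule norm_blinfun_compose)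
  obtain x :: 'a where x: "x \<noteq> 0" using nontrivial by blast
  have "norm x \<le> norm (id_blinfun :: 'a \<Rightarrow>\<^sub>L 'a) * norm x"
    using norm_blinfun[of id_blinfun x] by simp
  then have "norm (id_blinfun :: 'a \<Rightarrow>\<^sub>L 'a) = 1"
    using x norm_blinfun_id_le[where 'a = 'a] by (intro antisym) simp_all
  then show norm1: "norm (1 :: 'a bounded_op) = 1"
    by transfer
  then show "(0 :: 'a bounded_op) \<noteq> 1"
    by (metis norm_zero zero_neq_one)
qed

end

instance bounded_op :: (complex_hilbert_space) banach
proof
  fix X :: "nat \<Rightarrow> 'a bounded_op"
  assume "Cauchy X"
  let ?Y = "\<lambda>n. blinfun_of_op (X n)"
  have dist_eq: "dist S T = dist (blinfun_of_op S) (blinfun_of_op T)" for S T :: "'a bounded_op"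
    by (simp add: dist_bounded_op_def dist_norm norm_bounded_op.rep_eq minus_bounded_op.rep_eq)
  have "Cauchy ?Y"
    using \<open>Cauchy X\<close> by (simp add: Cauchy_def dist_eq)
  then obtain L where L: "?Y \<longlonglongrightarrow> L"
    using Cauchy_convergent_iff convergent_def by blast
  have "L (c *\<^sub>C x) = c *\<^sub>C L x" for c x
  proof (rule LIMSEQ_unique)
    show "(\<lambda>n. ?Y n (c *\<^sub>C x)) \<longlonglongrightarrow> L (c *\<^sub>C x)"
      by (rule blinfun.tendsto[OF L tendsto_const])
    have "(\<lambda>n. c *\<^sub>C ?Y n x) \<longlonglongrightarrow> c *\<^sub>C L x"
      by (rule bounded_linear.tendsto[OF bounded_linear_scaleC blinfun.tendsto[OF L tendsto_const]])
    moreover have "?Y n (c *\<^sub>C x) = c *\<^sub>C ?Y n x" for n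
      using blinfun_of_op[of "X n"] by simp
    ultimately show "(\<lambda>n. ?Y n (c *\<^sub>C x)) \<longlonglongrightarrow> c *\<^sub>C L x"
      by simp
  qed
  then have "blinfun_of_op (Op L) = L"
    by (simp add: Op_inverse)
  then have "X \<longlonglongrightarrow> Op L"
    using L by (simp add: tendsto_dist_iff[of X] tendsto_dist_iff[of ?Y] dist_eq)
  then show "convergent X"
    by (auto simp: convergent_def)
qed

text \<open>The adjoint exists and is unique by the Riesz representation theorem.\<close>

definition adj :: "'h::complex_hilbert_space bounded_op \<Rightarrow> 'h bounded_op" where
  "adj T = (THE S. \<forall>x y. cinner (op_apply T x) y = cinner x (op_apply S y))"

definition hermitian_op :: "'h::complex_hilbert_space bounded_op \<Rightarrow> bool" where
  "hermitian_op T \<longleftrightarrow> adj T = T"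

definition positive_op :: "'h::complex_hilbert_space bounded_op \<Rightarrow> bool" where
  "positive_op T \<longleftrightarrow> (\<forall>x. cinner (op_apply T x) x \<in> \<real>\<^sub>\<ge>\<^sub>0)"


section \<open>Commuting squares of finite dimensional von Neumann algebras\<close>

definition commutant :: "'h::complex_hilbert_space bounded_op set \<Rightarrow> 'h bounded_op set" where
  "commutant B = {a. \<forall>b\<in>B. a * b = b * a}"

text \<open>Every von Neumann algebra on H in this sense contains the identity of H, so inclusions are
  automatically unital.\<close>

definition von_neumann_algebra :: "'h::complex_hilbert_space bounded_op set \<Rightarrow> bool" where
  "von_neumann_algebra M \<longleftrightarrow> (\<forall>a\<in>M. adj a \<in> M) \<and> commutant (commutant M) = M"

definition fd_von_neumann_algebra :: "'h::complex_hilbert_space bounded_op set \<Rightarrow> bool" where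
  "fd_von_neumann_algebra M \<longleftrightarrow>
    von_neumann_algebra M \<and> (\<exists>B. finite B \<and> complex_span B = M)"

text \<open>Traces and conditional expectations are only constrained on the algebra P.\<close>

definition clinear_on ::
  "'a::complex_vector set \<Rightarrow> ('a \<Rightarrow> 'b::complex_vector) \<Rightarrow> bool" where
  "clinear_on P f \<longleftrightarrow>
    (\<forall>x\<in>P. \<forall>y\<in>P. f (x + y) = f x + f y) \<and> (\<forall>x\<in>P. \<forall>c. f (c *\<^sub>C x) = c *\<^sub>C f x)"

definition faithful_normalized_trace ::
  "'h::complex_hilbert_space bounded_op set \<Rightarrow> ('h bounded_op \<Rightarrow> complex) \<Rightarrow> bool" where
  "faithful_normalized_trace P \<tau> \<longleftrightarrow>
    clinear_on P \<tau> \<and>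
    (\<forall>x\<in>P. \<forall>y\<in>P. \<tau> (x * y) = \<tau> (y * x)) \<and>
    (\<forall>x\<in>P. \<tau> (adj x * x) \<in> \<real>\<^sub>\<ge>\<^sub>0) \<and>
    (\<forall>x\<in>P. \<tau> (adj x * x) = 0 \<longrightarrow> x = 0) \<and>
    \<tau> 1 = 1"

definition trace_preserving_cond_exp ::
  "'h::complex_hilbert_space bounded_op set \<Rightarrow> ('h bounded_op \<Rightarrow> complex) \<Rightarrow> 'h bounded_op set \<Rightarrow>
    ('h bounded_op \<Rightarrow> 'h bounded_op) \<Rightarrow> bool" where
  "trace_preserving_cond_exp P \<tau> A E \<longleftrightarrow>
    E \<in> P \<rightarrow>\<^sub>E A \<and>
    clinear_on P E \<and>
    (\<forall>a\<in>A. E a = a) \<and>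
    (\<forall>a\<in>A. \<forall>b\<in>A. \<forall>x\<in>P. E (a * x * b) = a * E x * b) \<and>
    (\<forall>x\<in>P. positive_op (E (adj x * x))) \<and>
    (\<forall>x\<in>P. \<tau> (E x) = \<tau> x)"

text \<open>For a faithful trace on a finite dimensional P and a von Neumann subalgebra A of P there is
  exactly one such map; extensionality
  outside P makes it unique as a HOL function.\<close>

definition cond_exp ::
  "'h::complex_hilbert_space bounded_op set \<Rightarrow> ('h bounded_op \<Rightarrow> complex) \<Rightarrow> 'h bounded_op set \<Rightarrow>
    'h bounded_op \<Rightarrow> 'h bounded_op" where
  "cond_exp P \<tau> A = (THE E. trace_preserving_cond_exp P \<tau> A E)"

text \<open>The arguments are the corners in the order upper left, upper right, lower left, lower right
  of the square, followed by the trace.\<close>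

definition commuting_square ::
  "'h::complex_hilbert_space bounded_op set \<Rightarrow> 'h bounded_op set \<Rightarrow> 'h bounded_op set \<Rightarrow>
    'h bounded_op set \<Rightarrow> ('h bounded_op \<Rightarrow> complex) \<Rightarrow> bool" where
  "commuting_square P\<^sub>1 P\<^sub>0 Q\<^sub>1 Q\<^sub>0 \<tau> \<longleftrightarrow>
    fd_von_neumann_algebra P\<^sub>1 \<and> fd_von_neumann_algebra P\<^sub>0 \<and>
    fd_von_neumann_algebra Q\<^sub>1 \<and> fd_von_neumann_algebra Q\<^sub>0 \<and>
    Q\<^sub>1 \<subseteq> P\<^sub>1 \<and> P\<^sub>1 \<subseteq> P\<^sub>0 \<and> Q\<^sub>1 \<subseteq> Q\<^sub>0 \<and> Q\<^sub>0 \<subseteq> P\<^sub>0 \<and>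
    faithful_normalized_trace P\<^sub>0 \<tau> \<and>
    (\<forall>x\<in>P\<^sub>0. cond_exp P\<^sub>0 \<tau> P\<^sub>1 (cond_exp P\<^sub>0 \<tau> Q\<^sub>0 x) = cond_exp P\<^sub>0 \<tau> Q\<^sub>1 x)"

end

(* A square is commuting iff tau(x y) = tau(x E(y)) for x in P_{-1}, y in Q_0, where E is the
   conditional expectation onto Q_{-1}.  Expand U^* y U into the terms (-it)^i (it)^j / (i! j!)
   (pq)^i y (pq)^j.  Since p and q commute with each other and with Q_{-1}, the trace property and the
   commuting square relation give tau(x (pq)^i y (pq)^j) = tau(x p^k E(q^k y)) with k = i + j, so for
   k > 0 the terms of total degree k carry the factor (1 - 1)^k = 0.  Only tau(x E(y)) survives.

   The conditional expectations are the orthogonal projections for the trace inner product.  Their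
   positivity is obtained without spectral theory: if z is hermitian and tau(a^* a z) >= 0 for all a,
   then tau(exp(-s z)) is decreasing in s, so exp(-s z) stays weakly bounded as s grows, whereas the
   convex function s |-> <exp(-s z) h, h> would be unbounded if <z h, h> < 0. *)

theory Submission
  imports Defs
begin

section \<open>Adjoints\<close>

lemma cinner_add_right: "cinner x (y + z) = cinner x y + cinner x z"
  by (metis cinner_commute cinner_add_left complex_cnj_add)

lemma cinner_scaleC_right: "cinner x (c *\<^sub>C y) = cnj c * cinner x y"
  by (metis cinner_commute cinner_scaleC_left complex_cnj_mult)

lemma cinner_minus_left: "cinner (- x) y = - cinner x y"
  using cinner_scaleC_left[of "-1" x y] by simp

lemma cinner_minus_right: "cinner x (- y) = - cinner x y"
  using cinner_scaleC_right[of x "-1" y] by simp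

lemma cinner_diff_left: "cinner (x - z) y = cinner x y - cinner z y"
  using cinner_add_left[of x "- z" y] by (simp add: cinner_minus_left)

lemma cinner_diff_right: "cinner x (y - z) = cinner x y - cinner x z"
  using cinner_add_right[of x y "- z"] by (simp add: cinner_minus_right)

lemma cinner_zero_left [simp]: "cinner 0 y = 0"
  using cinner_diff_left[of y y y] by simp

lemma cinner_zero_right [simp]: "cinner y 0 = 0"
  using cinner_diff_right[of y y y] by simp

lemma cinner_self_eq_zero: "cinner x x = 0 \<longleftrightarrow> x = 0"
  by (simp add: cinner_self)

lemma cinner_ext:
  assumes "\<And>x. cinner x y = cinner x z"
  shows "y = z"
  using assms[of "y - z"] cinner_self_eq_zero[of "y - z"] by (simp add: cinner_diff_right)

lemma cinner_scaleR_left: "cinner (r *\<^sub>R x) y = r *\<^sub>R cinner x y"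
  using cinner_scaleC_left[of "complex_of_real r" x y]
  by (simp add: scaleC_of_real scaleR_conv_of_real)

lemma norm_add_sq: "(norm (x + y))\<^sup>2 = (norm x)\<^sup>2 + (norm y)\<^sup>2 + 2 * Re (cinner x y)"
  for x y :: "'a::complex_hilbert_space"
proof -
  have "complex_of_real ((norm (x + y))\<^sup>2) = cinner x x + cinner y y + (cinner x y + cnj (cinner x y))"
    unfolding cinner_self[symmetric] cinner_commute[of x y, symmetric] cinner_commute[of y x, symmetric]
    by (simp add: cinner_add_left cinner_add_right algebra_simps)
  also have "\<dots> = complex_of_real ((norm x)\<^sup>2 + (norm y)\<^sup>2 + 2 * Re (cinner x y))"
    by (simp add: cinner_self complex_add_cnj)
  finally show ?thesis using of_real_eq_iff by blast
qed

lemma parallelogram_law: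
  fixes x y :: "'a::complex_hilbert_space"
  shows "(norm (x + y))\<^sup>2 + (norm (x - y))\<^sup>2 = 2 * (norm x)\<^sup>2 + 2 * (norm y)\<^sup>2"
  using norm_add_sq[of x y] norm_add_sq[of x "- y"] by (simp add: cinner_minus_right)

text \<open>Cauchy-Schwarz: subtracting from \<open>x\<close> its orthogonal projection onto the
  line through \<open>y\<close> leaves a vector whose squared norm is nonnegative.\<close>

lemma cmod_cinner_le: "cmod (cinner x y) \<le> norm x * norm y"
proof (cases "y = 0")
  case False
  define c where "c = cinner x y / (norm y)\<^sup>2"
  have "(norm (x + (- c) *\<^sub>C y))\<^sup>2
      = (norm x)\<^sup>2 + (cmod c * norm y)\<^sup>2 + 2 * Re (- cnj c * cinner x y)"
    by (subst norm_add_sq) (simp only: norm_scaleC cinner_scaleC_right norm_minus_cancel complex_cnj_minus)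
  also have "cnj c * cinner x y = complex_of_real ((cmod c * norm y)\<^sup>2)"
  proof -
    have xy: "cinner x y = c * (norm y)\<^sup>2" using False by (simp add: c_def)
    show ?thesis unfolding xy using complex_norm_square[of c]
      by (simp add: power_mult_distrib mult_ac)
  qed
  then have "Re (- cnj c * cinner x y) = - (cmod c * norm y)\<^sup>2" by simp
  finally have "(cmod c * norm y)\<^sup>2 \<le> (norm x)\<^sup>2"
    using zero_le_power2[of "norm (x + (- c) *\<^sub>C y)"] by linarith
  then have "cmod c * norm y \<le> norm x" by (rule power2_le_imp_le) simp
  then show ?thesis
    using False by (simp add: c_def norm_divide norm_mult power2_eq_square divide_le_eq mult_ac)
qed simp

lemma bounded_linear_cinner_left: "bounded_linear (\<lambda>x. cinner x y)"
  by (rule bounded_linear_intro[where K = "norm y"])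
    (simp_all add: cinner_add_left cinner_scaleR_left cmod_cinner_le)

text \<open>The vector of least norm in the affine hyperplane where \<open>f\<close> is 1 is
  orthogonal to the kernel of \<open>f\<close>, so a multiple of it represents
  \<open>f\<close>.\<close>

lemma Riesz_representation:
  fixes f :: "'h::complex_hilbert_space \<Rightarrow> complex"
  assumes bl: "bounded_linear f" and hom: "\<And>c x. f (c *\<^sub>C x) = c * f x"
  obtains u where "\<And>x. f x = cinner x u"
proof (cases "\<forall>x. f x = 0")
  case True
  then show ?thesis using that[of 0] by simp
next
  case False
  interpret bounded_linear f by (rule bl)
  define H where "H = {x. f x = 1}"
  define d where "d = (INF x\<in>H. (norm x)\<^sup>2)"
  obtain x0 where "f x0 \<noteq> 0" using False by blast
  then have "(1 / f x0) *\<^sub>C x0 \<in> H" by (simp add: H_def hom)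
  then have "H \<noteq> {}" by blast
  have bdd: "bdd_below ((\<lambda>x. (norm x)\<^sup>2) ` H)" by (rule bdd_belowI[where m = 0]) auto
  have d_le: "d \<le> (norm x)\<^sup>2" if "x \<in> H" for x
    unfolding d_def using bdd that by (rule cINF_lower)
  have "\<exists>x\<in>H. (norm x)\<^sup>2 < d + e" if "e > 0" for e
    using cINF_less_iff[OF \<open>H \<noteq> {}\<close> bdd, of "d + e"] that by (simp add: d_def)
  then have "\<forall>n. \<exists>x\<in>H. (norm x)\<^sup>2 < d + inverse (real (Suc n))" by simp
  then obtain X where XH: "\<And>n. X n \<in> H" and Xn: "\<And>n. (norm (X n))\<^sup>2 < d + inverse (real (Suc n))"
    by metis
  \<comment> \<open>The midpoint of \<open>x\<close> and \<open>y\<close> stays in \<open>H\<close>,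
    so its squared norm is at least \<open>d\<close>; the parallelogram law then makes
    near-minimisers close to each other.\<close>
  have dist_le: "(norm (x - y))\<^sup>2 \<le> 2 * (norm x)\<^sup>2 + 2 * (norm y)\<^sup>2 - 4 * d"
    if "x \<in> H" "y \<in> H" for x y
  proof -
    have "(1/2) *\<^sub>R (x + y) \<in> H" using that by (simp add: H_def scaleR add scaleR_conv_of_real)
    from d_le[OF this] have "4 * d \<le> (norm (x + y))\<^sup>2" by (simp add: power_divide)
    then show ?thesis using parallelogram_law[of x y] by linarith
  qed
  have "Cauchy X"
  proof (rule CauchyI)
    fix e :: real assume "0 < e"
    \<comment> \<open>Both squared norms exceed \<open>d\<close> by less than a quarter of the
      square of \<open>e\<close>, and \<open>dist_le\<close> counts each excess twice.\<close>
    then obtain N where N: "inverse (real (Suc N)) < e\<^sup>2 / 4"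
      using reals_Archimedean[of "e\<^sup>2 / 4"] by auto
    have "norm (X m - X n) < e" if "m \<ge> N" "n \<ge> N" for m n
    proof -
      have "inverse (real (Suc m)) \<le> inverse (real (Suc N))"
        "inverse (real (Suc n)) \<le> inverse (real (Suc N))"
        using that by (auto intro!: le_imp_inverse_le)
      then have "(norm (X m - X n))\<^sup>2 < e\<^sup>2"
        using dist_le[OF XH[of m] XH[of n]] Xn[of m] Xn[of n] N by linarith
      then show ?thesis using \<open>0 < e\<close> by (meson less_imp_le power_less_imp_less_base)
    qed
    then show "\<exists>M. \<forall>m\<ge>M. \<forall>n\<ge>M. norm (X m - X n) < e" by blast
  qed
  then obtain u where u: "X \<longlonglongrightarrow> u" using Cauchy_convergent_iff convergent_def by blast
  have fu: "f u = 1"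
  proof (rule LIMSEQ_unique)
    show "(\<lambda>n. f (X n)) \<longlonglongrightarrow> f u" using u by (rule tendsto)
    show "(\<lambda>n. f (X n)) \<longlonglongrightarrow> 1" using XH by (simp add: H_def)
  qed
  have nu: "(norm u)\<^sup>2 \<le> d"
  proof (rule LIMSEQ_le)
    show "(\<lambda>n. (norm (X n))\<^sup>2) \<longlonglongrightarrow> (norm u)\<^sup>2" by (intro tendsto_intros u)
    show "(\<lambda>n. d + inverse (real (Suc n))) \<longlonglongrightarrow> d"
      using tendsto_add[OF tendsto_const LIMSEQ_inverse_real_of_nat, of d] by simp
    show "\<exists>N. \<forall>n\<ge>N. (norm (X n))\<^sup>2 \<le> d + inverse (real (Suc n))" using Xn less_imp_le by blast
  qed
  \<comment> \<open>Moving from \<open>u\<close> along a kernel vector \<open>v\<close> stays in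
    \<open>H\<close>. Removing the component \<open>c\<close> of \<open>u\<close> along
    \<open>v\<close> lowers the squared norm by the square of \<open>cmod c * norm v\<close>, so
    minimality forces \<open>c = 0\<close>.\<close>
  have orth: "cinner v u = 0" if "f v = 0" for v
  proof (cases "v = 0")
    case False
    define c where "c = cinner u v / (norm v)\<^sup>2"
    have "u + (- c) *\<^sub>C v \<in> H"
      using that fu by (simp only: H_def add hom mem_Collect_eq) simp
    then have "(norm u)\<^sup>2 \<le> (norm (u + (- c) *\<^sub>C v))\<^sup>2" by (rule order_trans[OF nu d_le])
    also have "\<dots> = (norm u)\<^sup>2 + (cmod c * norm v)\<^sup>2 + 2 * Re (- cnj c * cinner u v)"
      by (subst norm_add_sq) (simp only: norm_scaleC cinner_scaleC_right norm_minus_cancel complex_cnj_minus)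
    also have "cinner u v = c * (norm v)\<^sup>2" using False by (simp add: c_def)
    also have "- cnj c * (c * complex_of_real ((norm v)\<^sup>2)) = complex_of_real (- (cmod c * norm v)\<^sup>2)"
      using complex_norm_square[of c] by (simp add: power_mult_distrib mult_ac)
    finally have "(cmod c * norm v)\<^sup>2 \<le> 0" by simp
    then have "c = 0" using False by simp
    then have "cinner u v = 0" using False by (simp add: c_def)
    then show ?thesis using cinner_commute[of v u] by simp
  qed simp
  have "f x = cinner x ((1 / (norm u)\<^sup>2) *\<^sub>C u)" for x
  proof -
    \<comment> \<open>Splits \<open>x\<close> into a kernel vector and a multiple of
      \<open>u\<close>; only the latter pairs with \<open>u\<close>.\<close>
    have "f (x - f x *\<^sub>C u) = 0" by (simp add: diff hom fu)
    then have "cinner x u = f x * (norm u)\<^sup>2"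
      using orth[of "x - f x *\<^sub>C u"] by (simp add: cinner_diff_left cinner_scaleC_left cinner_self)
    moreover have "u \<noteq> 0" using fu zero by auto
    ultimately show ?thesis by (simp add: cinner_scaleC_right)
  qed
  then show ?thesis using that by blast
qed

section \<open>Operators on H and their adjoints\<close>

lemma op_apply_simps:
  "op_apply (S + T) x = op_apply S x + op_apply T x"
  "op_apply (S - T) x = op_apply S x - op_apply T x"
  "op_apply (- T) x = - op_apply T x"
  "op_apply (S * T) x = op_apply S (op_apply T x)"
  "op_apply (c *\<^sub>C T) x = c *\<^sub>C op_apply T x"
  "op_apply (r *\<^sub>R T) x = r *\<^sub>R op_apply T x"
  "op_apply 0 x = 0"
  "op_apply 1 x = x"
  by (transfer, simp add: blinfun.bilinear_simps blinfun_scaleC.rep_eq)+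

lemma op_apply_scaleC: "op_apply T (c *\<^sub>C x) = c *\<^sub>C op_apply T x"
  by transfer simp

lemma op_ext: "(\<And>x. op_apply S x = op_apply T x) \<Longrightarrow> S = T"
  by transfer (rule blinfun_eqI)

lemma bounded_linear_op_apply: "bounded_linear (op_apply T)"
  by (simp add: op_apply.rep_eq blinfun.bounded_linear_right)

lemma norm_op_apply_le: "norm (op_apply T x) \<le> norm T * norm x"
  by transfer (rule norm_blinfun)

lemma bounded_linear_op_apply_left: "bounded_linear (\<lambda>T. op_apply T x)"
  by (rule bounded_linear_intro[where K = "norm x"])
    (simp_all add: op_apply_simps norm_op_apply_le)

lemma op_of_bounded_linear:
  fixes f :: "'h::complex_hilbert_space \<Rightarrow> 'h"
  assumes "bounded_linear f" "\<And>c x. f (c *\<^sub>C x) = c *\<^sub>C f x"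
  obtains T where "\<And>x. op_apply T x = f x"
proof
  show "op_apply (Op (Blinfun f)) x = f x" for x
    using assms by (simp add: op_apply.rep_eq Op_inverse bounded_linear_Blinfun_apply)
qed

text \<open>For each \<open>y\<close> the Riesz theorem represents the functional sending
  \<open>x\<close> to \<open>cinner (op_apply T x) y\<close>; the representing vectors depend
  linearly and boundedly on \<open>y\<close>.\<close>

lemma adjoint_exists:
  fixes T :: "'h::complex_hilbert_space bounded_op"
  obtains S where "\<And>x y. cinner (op_apply T x) y = cinner x (op_apply S y)"
proof -
  have "\<exists>u. \<forall>x. cinner (op_apply T x) y = cinner x u" for y
    by (rule Riesz_representation
        [OF bounded_linear_compose[OF bounded_linear_cinner_left bounded_linear_op_apply]])
      (auto simp: op_apply_scaleC cinner_scaleC_left)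
  then obtain s where s: "\<And>x y. cinner (op_apply T x) y = cinner x (s y)" by metis
  have "bounded_linear s"
  proof (rule bounded_linear_intro[where K = "norm T"])
    show "s (y + z) = s y + s z" for y z
      by (rule cinner_ext) (simp add: s[symmetric] cinner_add_right)
    show "s (r *\<^sub>R y) = r *\<^sub>R s y" for r y
      unfolding scaleC_of_real[symmetric]
      by (rule cinner_ext) (simp add: s[symmetric] cinner_scaleC_right)
    show "norm (s y) \<le> norm y * norm T" for y
    proof (cases "s y = 0")
      case False
      \<comment> \<open>The defining identity of \<open>s\<close> is taken at
        \<open>x = s y\<close>; dividing the resulting estimate by \<open>norm (s y)\<close> gives
        the bound.\<close>
      have "(norm (s y))\<^sup>2 = cmod (cinner (op_apply T (s y)) y)"
        by (simp add: s cinner_self norm_power)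
      also have "\<dots> \<le> norm (op_apply T (s y)) * norm y" by (rule cmod_cinner_le)
      also have "\<dots> \<le> (norm T * norm (s y)) * norm y"
        by (intro mult_right_mono norm_op_apply_le) simp
      finally show ?thesis using False by (simp add: power2_eq_square mult_ac)
    qed simp
  qed
  moreover have "s (c *\<^sub>C y) = c *\<^sub>C s y" for c y
    by (rule cinner_ext) (simp add: s[symmetric] cinner_scaleC_right)
  ultimately obtain S where "\<And>x. op_apply S x = s x" by (rule op_of_bounded_linear) blast
  then show ?thesis using that[of S] s by simp
qed

text \<open>Nondegeneracy of the inner product resolves the definite description of
  \<open>adj\<close>. The algebraic rules for \<open>adj\<close> follow by verifying this identity
  for a candidate.\<close>

lemma adj_unique:
  assumes "\<And>x y. cinner (op_apply T x) y = cinner x (op_apply S y)"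
  shows "adj T = S"
  unfolding adj_def
proof (rule the_equality)
  show "\<forall>x y. cinner (op_apply T x) y = cinner x (op_apply S y)" using assms by blast
  fix R assume "\<forall>x y. cinner (op_apply T x) y = cinner x (op_apply R y)"
  then have "cinner x (op_apply R y) = cinner x (op_apply S y)" for x y
    by (simp flip: assms)
  then show "R = S" by (blast intro: op_ext cinner_ext)
qed

lemma cinner_adj_right: "cinner x (op_apply (adj T) y) = cinner (op_apply T x) y"
proof -
  obtain S where S: "\<And>x y. cinner (op_apply T x) y = cinner x (op_apply S y)"
    by (rule adjoint_exists) blast
  then have "adj T = S" by (rule adj_unique)
  with S show ?thesis by simp
qed

lemma cinner_adj_left: "cinner (op_apply (adj T) x) y = cinner x (op_apply T y)"
  by (metis cinner_commute cinner_adj_right)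

lemma adj_adj [simp]: "adj (adj T) = T"
  by (rule adj_unique) (rule cinner_adj_left)

lemma adj_add: "adj (S + T) = adj S + adj T"
  by (rule adj_unique) (simp add: op_apply_simps cinner_add_left cinner_add_right cinner_adj_right)

lemma adj_diff: "adj (S - T) = adj S - adj T"
  by (rule adj_unique) (simp add: op_apply_simps cinner_diff_left cinner_diff_right cinner_adj_right)

lemma adj_mult: "adj (S * T) = adj T * adj S"
  by (rule adj_unique) (simp add: op_apply_simps cinner_adj_right)

lemma adj_scaleC: "adj (c *\<^sub>C T) = cnj c *\<^sub>C adj T"
  by (rule adj_unique)
    (simp add: op_apply_simps cinner_scaleC_left cinner_scaleC_right cinner_adj_right)

lemma adj_uminus: "adj (- T) = - adj T"
  using adj_scaleC[of "-1" T] by simp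

lemma adj_one [simp]: "adj 1 = 1"
  by (rule adj_unique) (simp add: op_apply_simps)

lemma adj_scaleR: "adj (r *\<^sub>R T) = r *\<^sub>R adj T"
  using adj_scaleC[of "complex_of_real r" T] by (simp add: scaleC_of_real)

lemma norm_adj_le: "norm (adj T) \<le> norm T"
proof -
  have "norm (op_apply (adj T) y) \<le> norm T * norm y" for y
  proof (cases "op_apply (adj T) y = 0")
    case False
    have "(norm (op_apply (adj T) y))\<^sup>2 = cmod (cinner (op_apply T (op_apply (adj T) y)) y)"
      by (simp flip: cinner_adj_right add: cinner_self norm_power)
    also have "\<dots> \<le> norm (op_apply T (op_apply (adj T) y)) * norm y" by (rule cmod_cinner_le)
    also have "\<dots> \<le> (norm T * norm (op_apply (adj T) y)) * norm y"
      by (intro mult_right_mono norm_op_apply_le) simp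
    finally show ?thesis using False by (simp add: power2_eq_square mult_ac)
  qed simp
  then show ?thesis
    by (simp add: norm_bounded_op.rep_eq op_apply.rep_eq norm_blinfun_bound)
qed

lemma bounded_linear_adj: "bounded_linear adj"
  by (rule bounded_linear_intro[where K = 1]) (simp_all add: adj_add adj_scaleR norm_adj_le)

lemma adj_power: "adj (T ^ n) = adj T ^ n"
  by (induction n) (simp_all add: adj_mult power_commutes)

text \<open>\<open>adj\<close> is bounded and real-linear, so it passes through the exponential
  series, whose coefficients are real.\<close>

lemma adj_exp: "adj (exp T) = exp (adj T)"
proof -
  have "(\<lambda>n. adj (T ^ n /\<^sub>R fact n)) sums adj (exp T)"
    by (rule bounded_linear.sums[OF bounded_linear_adj exp_converges])
  then have "(\<lambda>n. adj T ^ n /\<^sub>R fact n) sums adj (exp T)"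
    by (simp add: adj_scaleR adj_power)
  with exp_converges show ?thesis using sums_unique2 by blast
qed

lemma mult_scaleC_left: "(c *\<^sub>C S) * T = c *\<^sub>C (S * T)" for S T :: "'h::complex_hilbert_space bounded_op"
  by (rule op_ext) (simp add: op_apply_simps)

lemma mult_scaleC_right: "S * (c *\<^sub>C T) = c *\<^sub>C (S * T)" for S T :: "'h::complex_hilbert_space bounded_op"
  by (rule op_ext) (simp add: op_apply_simps op_apply_scaleC)

section \<open>Conditional expectations\<close>

lemma exp_commute:
  fixes a b :: "'a::{real_normed_algebra_1,banach}"
  assumes "a * b = b * a"
  shows "exp a * b = b * exp a"
proof -
  have pow: "a ^ n * b = b * a ^ n" for n
    using assms by (induction n) (simp_all add: mult.assoc, metis mult.assoc)
  have "(\<lambda>n. (a ^ n /\<^sub>R fact n) * b) sums (exp a * b)"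
    by (rule bounded_linear.sums[OF bounded_linear_mult_left exp_converges])
  moreover have "(\<lambda>n. b * (a ^ n /\<^sub>R fact n)) sums (b * exp a)"
    by (rule bounded_linear.sums[OF bounded_linear_mult_right exp_converges])
  ultimately show ?thesis using sums_unique2 by (simp add: pow)
qed

context
  fixes M :: "'h::complex_hilbert_space bounded_op set"
  assumes vN: "von_neumann_algebra M"
begin

text \<open>The bicommutant condition turns membership into a commutation check. Closure under
  algebraic operations and under \<open>exp\<close> then needs no topology on
  \<open>M\<close>.\<close>

lemma vN_memI: "(\<And>b. b \<in> commutant M \<Longrightarrow> a * b = b * a) \<Longrightarrow> a \<in> M"
  using vN by (auto simp: von_neumann_algebra_def commutant_def)

lemma vN_commute: "a \<in> M \<Longrightarrow> b \<in> commutant M \<Longrightarrow> a * b = b * a"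
  by (auto simp: commutant_def)

lemma vN_adj: "a \<in> M \<Longrightarrow> adj a \<in> M"
  using vN by (auto simp: von_neumann_algebra_def)

lemma vN_one: "1 \<in> M"
  by (rule vN_memI) simp

lemma vN_zero: "0 \<in> M"
  by (rule vN_memI) simp

lemma vN_add: "a \<in> M \<Longrightarrow> b \<in> M \<Longrightarrow> a + b \<in> M"
  by (rule vN_memI) (simp add: vN_commute algebra_simps)

lemma vN_mult: "a \<in> M \<Longrightarrow> b \<in> M \<Longrightarrow> a * b \<in> M"
proof (rule vN_memI)
  fix c assume "a \<in> M" "b \<in> M" "c \<in> commutant M"
  then have "a * c = c * a" "b * c = c * b" using vN_commute by blast+
  then show "a * b * c = c * (a * b)" by (simp add: mult.assoc) (simp flip: mult.assoc)
qed

lemma vN_scaleC: "a \<in> M \<Longrightarrow> c *\<^sub>C a \<in> M"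
  by (rule vN_memI) (simp add: vN_commute mult_scaleC_left mult_scaleC_right)

lemma vN_scaleR: "a \<in> M \<Longrightarrow> r *\<^sub>R a \<in> M"
  using vN_scaleC[of a "complex_of_real r"] by (simp add: scaleC_of_real)

lemma vN_uminus: "a \<in> M \<Longrightarrow> - a \<in> M"
  using vN_scaleC[of a "-1"] by simp

lemma vN_diff: "a \<in> M \<Longrightarrow> b \<in> M \<Longrightarrow> a - b \<in> M"
  using vN_add[of a "- b"] vN_uminus by simp

lemma vN_power: "a \<in> M \<Longrightarrow> a ^ n \<in> M"
  by (induction n) (simp_all add: vN_one vN_mult)

lemma vN_exp: "a \<in> M \<Longrightarrow> exp a \<in> M"
  by (rule vN_memI) (simp add: exp_commute vN_commute)

lemmas vN_closed = vN_adj vN_one vN_zero vN_add vN_mult vN_scaleC vN_scaleR vN_uminus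
  vN_diff vN_power vN_exp

end

section \<open>Linear functionals on finite dimensional spaces\<close>

lemma clinear_on_zero:
  assumes "clinear_on V f" "complex_vector.subspace V"
  shows "f 0 = 0"
proof -
  have "f (0 *\<^sub>C 0) = 0 *\<^sub>C f 0"
    using assms complex_vector.subspace_0 unfolding clinear_on_def by blast
  then show ?thesis by simp
qed

lemma clinear_on_sum:
  assumes f: "clinear_on V f" and V: "complex_vector.subspace V"
    and "finite C" "C \<subseteq> V"
  shows "f (\<Sum>i\<in>C. c i *\<^sub>C i) = (\<Sum>i\<in>C. c i *\<^sub>C f i)"
  using assms(3,4)
proof (induction C)
  case empty
  then show ?case using clinear_on_zero[OF f V] by simp
next
  case (insert b C)
  have "(\<Sum>i\<in>C. c i *\<^sub>C i) \<in> V"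
    using insert V by (intro complex_vector.subspace_sum complex_vector.subspace_scale) auto
  moreover have "c b *\<^sub>C b \<in> V" "b \<in> V"
    using insert V by (auto intro: complex_vector.subspace_scale)
  ultimately show ?case using insert f by (simp add: clinear_on_def)
qed

text \<open>The proof builds, one basis vector at a time, a basis of the dual space out of members of F.\<close>

lemma separating_functionals_exhaust_dual:
  fixes F :: "('v::complex_vector \<Rightarrow> complex) set"
  assumes "finite B" and V: "complex_span B = V"
    and F0: "(\<lambda>_. 0) \<in> F" and Fadd: "\<And>f g c. f \<in> F \<Longrightarrow> g \<in> F \<Longrightarrow> (\<lambda>x. f x + c * g x) \<in> F"
    and lin: "\<And>f. f \<in> F \<Longrightarrow> clinear_on V f"
    and sep: "\<And>x. x \<in> V \<Longrightarrow> x \<noteq> 0 \<Longrightarrow> \<exists>f\<in>F. f x \<noteq> 0"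
    and \<phi>: "clinear_on V \<phi>"
  obtains g where "g \<in> F" "\<And>x. x \<in> V \<Longrightarrow> g x = \<phi> x"
proof -
  have sub: "complex_vector.subspace V"
    using V complex_vector.subspace_span by auto
  have Fsum: "(\<lambda>x. \<Sum>i\<in>C. c i * h i x) \<in> F" if "finite C" "\<And>i. i \<in> C \<Longrightarrow> h i \<in> F"
    for C :: "'v set" and c h
    using that
  proof (induction C)
    case (insert i C)
    then have "(\<lambda>x. (\<Sum>i\<in>C. c i * h i x) + c i * h i x) \<in> F" by (intro Fadd) auto
    with insert show ?case by (simp add: add.commute)
  qed (simp add: F0)
  obtain B' where B': "B' \<subseteq> B" "complex_vector.independent B'" "B \<subseteq> complex_span B'"
    by (rule complex_vector.maximal_independent_subset)
  have "finite B'" using B'(1) assms(1) finite_subset by blast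
  have spanB': "complex_span B' = V"
    using B' V complex_vector.span_mono complex_vector.span_minimal complex_vector.subspace_span
    by (metis subset_antisym)
  have dual: "\<exists>d. (\<forall>b\<in>C. d b \<in> F) \<and> (\<forall>b\<in>C. \<forall>c\<in>C. d b c = (if b = c then 1 else 0))"
    if "finite C" "C \<subseteq> V" "complex_vector.independent C" for C
    using that
  proof (induction C)
    case (insert b C)
    have indC: "complex_vector.independent C"
      using insert.prems(2) complex_vector.independent_mono by blast
    then obtain d where dF: "\<And>i. i \<in> C \<Longrightarrow> d i \<in> F"
      and d: "\<And>i j. i \<in> C \<Longrightarrow> j \<in> C \<Longrightarrow> d i j = (if i = j then 1 else 0)"
      using insert by (metis insert_subset)
    have CV: "C \<subseteq> V" and bV: "b \<in> V" using insert.prems by auto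
    \<comment> \<open>\<open>s\<close> is the element of the span of \<open>C\<close> on which every
      \<open>d i\<close> takes the same value as on \<open>b\<close>; independence makes
      \<open>b - s\<close> nonzero.\<close>
    define s where "s = (\<Sum>i\<in>C. d i b *\<^sub>C i)"
    have sC: "s \<in> complex_span C"
      unfolding s_def
      by (intro complex_vector.span_sum complex_vector.span_scale complex_vector.span_base)
    then have sV: "s \<in> V"
      using CV sub complex_vector.span_minimal by blast
    have "b \<notin> complex_span C"
      using insert.prems(2) insert.hyps(2) by (simp add: complex_vector.independent_insert)
    then have "b - s \<noteq> 0" using sC by auto
    then obtain f where fF: "f \<in> F" and fb: "f (b - s) \<noteq> 0"
      using sep[of "b - s"] bV sV sub complex_vector.subspace_diff by blast
    \<comment> \<open>Subtracting the interpolation of \<open>f\<close> on \<open>C\<close> makes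
      \<open>f'\<close> vanish on \<open>C\<close>, while its value at \<open>b\<close> is
      \<open>f (b - s)\<close>.\<close>
    define f' where "f' = (\<lambda>x. f x + (-1) * (\<Sum>i\<in>C. f i * d i x))"
    have f'F: "f' \<in> F" unfolding f'_def
      by (intro Fadd fF Fsum insert.hyps dF)
    have f'C: "f' j = 0" if "j \<in> C" for j
    proof -
      have "(\<Sum>i\<in>C. f i * d i j) = (\<Sum>i\<in>C. if i = j then f i else 0)"
        by (rule sum.cong) (use d that in auto)
      then show ?thesis using that insert.hyps by (simp add: f'_def)
    qed
    have fdiff: "f (x - y) = f x - f y" if "x \<in> V" "y \<in> V" for x y
    proof -
      have "f x = f (x - y + y)" by simp
      also have "\<dots> = f (x - y) + f y"
        using lin[OF fF] that sub complex_vector.subspace_diff unfolding clinear_on_def by blast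
      finally show ?thesis by simp
    qed
    have "f' b = f (b - s)"
      using clinear_on_sum[OF lin[OF fF] sub insert.hyps(1) CV, of "\<lambda>i. d i b"]
      by (simp add: f'_def fdiff bV sV s_def[symmetric] scaleC_complex_def mult.commute)
    with fb have f'b: "f' b \<noteq> 0" by simp
    \<comment> \<open>The scaling gives \<open>e\<close> the value 1 at \<open>b\<close>; the
      leading \<open>0 +\<close> matches the shape of \<open>Fadd\<close>.\<close>
    define e where "e = (\<lambda>x. 0 + (1 / f' b) * f' x)"
    have eF: "e \<in> F" unfolding e_def by (rule Fadd[OF F0 f'F])
    \<comment> \<open>The old functionals are corrected to vanish at \<open>b\<close>; on
      \<open>C\<close> they are unchanged because \<open>e\<close> is zero there.\<close>
    define d' where "d' = (\<lambda>i. if i = b then e else (\<lambda>x. d i x + (- d i b) * e x))"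
    have "d' i \<in> F" if "i \<in> insert b C" for i
      using that eF Fadd[OF dF eF, of i "- d i b"] by (cases "i = b") (auto simp: d'_def)
    moreover have "d' i j = (if i = j then 1 else 0)" if "i \<in> insert b C" "j \<in> insert b C" for i j
      using that f'C f'b d insert.hyps(2) by (auto simp: d'_def e_def)
    ultimately show ?case by blast
  qed simp
  have "B' \<subseteq> V" using spanB' complex_vector.span_superset by blast
  then obtain d where dF: "\<And>i. i \<in> B' \<Longrightarrow> d i \<in> F"
    and d: "\<And>i j. i \<in> B' \<Longrightarrow> j \<in> B' \<Longrightarrow> d i j = (if i = j then 1 else 0)"
    using dual[OF \<open>finite B'\<close>] B'(2) by metis
  \<comment> \<open>\<open>g\<close> interpolates \<open>\<phi>\<close> on the basis
    \<open>B'\<close>, hence agrees with it on the span.\<close>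
  define g where "g = (\<lambda>x. \<Sum>i\<in>B'. \<phi> i * d i x)"
  have gF: "g \<in> F" unfolding g_def using \<open>finite B'\<close> dF by (rule Fsum)
  have gB: "g j = \<phi> j" if "j \<in> B'" for j
  proof -
    have "g j = (\<Sum>i\<in>B'. if i = j then \<phi> i else 0)"
      unfolding g_def by (rule sum.cong) (use d that in auto)
    then show ?thesis using that \<open>finite B'\<close> by simp
  qed
  have "g x = \<phi> x" if "x \<in> V" for x
  proof -
    obtain u where x: "x = (\<Sum>i\<in>B'. u i *\<^sub>C i)"
      using \<open>x \<in> V\<close> spanB' complex_vector.span_finite[OF \<open>finite B'\<close>] by auto
    have eq: "f x = (\<Sum>i\<in>B'. u i *\<^sub>C f i)" if "clinear_on V f" for f :: "'v \<Rightarrow> complex"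
      unfolding x using that sub \<open>finite B'\<close> \<open>B' \<subseteq> V\<close> by (rule clinear_on_sum)
    show ?thesis by (simp add: eq[OF lin[OF gF]] eq[OF \<phi>] gB)
  qed
  with gF that show ?thesis by blast
qed

section \<open>Faithful traces and their conditional expectations\<close>

locale traced_algebra =
  fixes P :: "'h::complex_hilbert_space bounded_op set" and \<tau> :: "'h bounded_op \<Rightarrow> complex"
  assumes fd: "fd_von_neumann_algebra P"
    and trace: "faithful_normalized_trace P \<tau>"
begin

lemma vN: "von_neumann_algebra P"
  using fd by (simp add: fd_von_neumann_algebra_def)

lemmas P_closed = vN_closed[OF vN]

lemma tau_linear: "clinear_on P \<tau>"
  using trace by (simp add: faithful_normalized_trace_def)

lemma tau_add: "x \<in> P \<Longrightarrow> y \<in> P \<Longrightarrow> \<tau> (x + y) = \<tau> x + \<tau> y"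
  using tau_linear by (simp add: clinear_on_def)

lemma tau_scaleC: "x \<in> P \<Longrightarrow> \<tau> (c *\<^sub>C x) = c * \<tau> x"
  using tau_linear by (simp add: clinear_on_def scaleC_complex_def)

lemma tau_uminus: "x \<in> P \<Longrightarrow> \<tau> (- x) = - \<tau> x"
  using tau_scaleC[of x "-1"] by simp

lemma tau_diff: "x \<in> P \<Longrightarrow> y \<in> P \<Longrightarrow> \<tau> (x - y) = \<tau> x - \<tau> y"
  using tau_add[of x "- y"] by (simp add: tau_uminus P_closed)

lemma tau_comm: "x \<in> P \<Longrightarrow> y \<in> P \<Longrightarrow> \<tau> (x * y) = \<tau> (y * x)"
  using trace by (simp add: faithful_normalized_trace_def)

lemma tau_one: "\<tau> 1 = 1"
  using trace by (simp add: faithful_normalized_trace_def)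

lemma tau_pos: "x \<in> P \<Longrightarrow> \<tau> (adj x * x) \<in> \<real>\<^sub>\<ge>\<^sub>0"
  using trace by (simp add: faithful_normalized_trace_def)

lemma tau_faithful: "x \<in> P \<Longrightarrow> \<tau> (adj x * x) = 0 \<Longrightarrow> x = 0"
  using trace by (simp add: faithful_normalized_trace_def)

text \<open>Polarisation: positivity at \<open>x + 1\<close> makes the sum of
  \<open>\<tau> (adj x)\<close> and \<open>\<tau> x\<close> real, and positivity at
  \<open>x + \<i> *\<^sub>C 1\<close> makes their difference imaginary.\<close>

lemma tau_adj:
  assumes "x \<in> P"
  shows "\<tau> (adj x) = cnj (\<tau> x)"
proof (rule complex_eqI)
  have "\<tau> (adj (x + 1) * (x + 1)) = \<tau> (adj x * x) + \<tau> (adj x) + \<tau> x + 1"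
    using assms by (simp add: adj_add algebra_simps tau_add P_closed tau_one)
  then show "Im (\<tau> (adj x)) = Im (cnj (\<tau> x))"
    using tau_pos[of "x + 1"] tau_pos[of x] assms
    by (simp add: P_closed complex_nonneg_Reals_iff)
  have "\<tau> (adj (x + \<i> *\<^sub>C 1) * (x + \<i> *\<^sub>C 1)) = \<tau> (adj x * x) + \<i> * \<tau> (adj x) - \<i> * \<tau> x + 1"
    using assms
    by (simp add: adj_add adj_scaleC algebra_simps tau_add tau_diff tau_scaleC tau_uminus P_closed tau_one
        mult_scaleC_left mult_scaleC_right scaleC_scaleC)
  then show "Re (\<tau> (adj x)) = Re (cnj (\<tau> x))"
    using tau_pos[of "x + \<i> *\<^sub>C 1"] tau_pos[of x] assms
    by (simp add: P_closed complex_nonneg_Reals_iff)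
qed

text \<open>Provides a continuous functional to apply to series and derivatives, since
  \<open>\<tau>\<close> is constrained only on \<open>P\<close> and only algebraically. Vector
  functionals separate operators, so bounded functionals exhaust the dual of
  \<open>P\<close>.\<close>

lemma tau_bounded_extension:
  obtains \<tau>' where "bounded_linear \<tau>'" "\<And>c x. \<tau>' (c *\<^sub>C x) = c * \<tau>' x"
    "\<And>x. x \<in> P \<Longrightarrow> \<tau>' x = \<tau> x"
proof -
  obtain B where B: "finite B" "complex_span B = P"
    using fd by (auto simp: fd_von_neumann_algebra_def)
  define F where "F = {f :: 'h bounded_op \<Rightarrow> complex. bounded_linear f \<and> (\<forall>c x. f (c *\<^sub>C x) = c * f x)}"
  have sep: "\<exists>f\<in>F. f T \<noteq> 0" if "T \<noteq> 0" for T
  proof -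
    have "\<exists>h. op_apply T h \<noteq> op_apply 0 h" using that op_ext by blast
    then obtain h where h: "op_apply T h \<noteq> 0" by (auto simp: op_apply_simps)
    \<comment> \<open>At \<open>T\<close> this functional takes the value
      \<open>cinner (op_apply T h) (op_apply T h)\<close>, which is nonzero.\<close>
    have "(\<lambda>S. cinner (op_apply S h) (op_apply T h)) \<in> F"
      by (simp add: F_def op_apply_simps cinner_scaleC_left
          bounded_linear_compose[OF bounded_linear_cinner_left bounded_linear_op_apply_left])
    then show ?thesis
      using h by (intro bexI[of _ "\<lambda>S. cinner (op_apply S h) (op_apply T h)"])
        (auto simp: cinner_self_eq_zero)
  qed
  have Fadd: "(\<lambda>x. f x + c * g x) \<in> F" if "f \<in> F" "g \<in> F" for f g c
    using that
    by (auto simp: F_def algebra_simps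
        intro!: bounded_linear_add bounded_linear_const_mult)
  have lin: "clinear_on P f" if "f \<in> F" for f
    using that by (auto simp: F_def clinear_on_def scaleC_complex_def linear_simps)
  have F0: "(\<lambda>_. 0) \<in> F" by (simp add: F_def)
  obtain g where "g \<in> F" "\<And>x. x \<in> P \<Longrightarrow> g x = \<tau> x"
    by (rule separating_functionals_exhaust_dual[OF B F0 Fadd lin sep tau_linear]) (assumption | erule that | blast)+
  then show ?thesis using that by (auto simp: F_def)
qed

text \<open>Riesz for the trace pairing on \<open>A\<close>: the functionals sending
  \<open>a\<close> to \<open>\<tau> (k * a)\<close> are closed under linear combinations, and
  faithfulness makes them separate points, with \<open>k = adj x\<close> detecting
  \<open>x\<close>.\<close>

lemma tau_representation:
  assumes A: "fd_von_neumann_algebra A" "A \<subseteq> P" and \<phi>: "clinear_on A \<phi>"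
  obtains k where "k \<in> A" "\<And>a. a \<in> A \<Longrightarrow> \<phi> a = \<tau> (k * a)"
proof -
  obtain B where B: "finite B" "complex_span B = A" and vNA: "von_neumann_algebra A"
    using A by (auto simp: fd_von_neumann_algebra_def)
  note A_closed = vN_closed[OF vNA]
  have AP: "x \<in> P" if "x \<in> A" for x using that A by blast
  obtain \<tau>' where \<tau>': "bounded_linear \<tau>'" "\<And>c x. \<tau>' (c *\<^sub>C x) = c * \<tau>' x"
    "\<And>x. x \<in> P \<Longrightarrow> \<tau>' x = \<tau> x"
    by (rule tau_bounded_extension) blast
  \<comment> \<open>The extension \<open>\<tau>'\<close> stands in for \<open>\<tau>\<close> because
    closure of \<open>F\<close> requires equality of functions on all operators, also outside
    \<open>P\<close>.\<close>
  define F where "F = (\<lambda>k a. \<tau>' (k * a)) ` A"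
  have \<tau>'_simps: "\<tau>' (x + y) = \<tau>' x + \<tau>' y" "\<tau>' 0 = 0" for x y
    using \<tau>'(1) by (simp_all add: linear_simps)
  have F0: "(\<lambda>_. 0) \<in> F"
    unfolding F_def using A_closed \<tau>'_simps by (intro image_eqI[of _ _ 0]) auto
  have Fadd: "(\<lambda>x. f x + c * g x) \<in> F" if fg: "f \<in> F" "g \<in> F" for f g c
  proof -
    obtain k l where kl: "k \<in> A" "l \<in> A" and "f = (\<lambda>a. \<tau>' (k * a))" "g = (\<lambda>a. \<tau>' (l * a))"
      using fg by (auto simp: F_def)
    then have "(\<lambda>x. f x + c * g x) = (\<lambda>a. \<tau>' ((k + c *\<^sub>C l) * a))"
      by (simp add: distrib_right mult_scaleC_left \<tau>'_simps \<tau>'(2))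
    then show ?thesis
      unfolding F_def using kl A_closed by (intro image_eqI[of _ _ "k + c *\<^sub>C l"]) auto
  qed
  have lin: "clinear_on A f" if "f \<in> F" for f
    using that
    by (auto simp: F_def clinear_on_def distrib_left mult_scaleC_right \<tau>'_simps \<tau>'(2)
        scaleC_complex_def)
  have sep: "\<exists>f\<in>F. f x \<noteq> 0" if "x \<in> A" "x \<noteq> 0" for x
    using that tau_faithful[of x] \<tau>'(3)[of "adj x * x"] AP A_closed P_closed
    unfolding F_def by (intro bexI[of _ "\<lambda>a. \<tau>' (adj x * a)"]) auto
  obtain g where "g \<in> F" "\<And>x. x \<in> A \<Longrightarrow> g x = \<phi> x"
    by (rule separating_functionals_exhaust_dual[OF B F0 Fadd lin sep \<phi>]) (assumption | erule that | blast)+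
  then obtain k where "k \<in> A" "\<And>a. a \<in> A \<Longrightarrow> \<phi> a = \<tau>' (k * a)"
    by (auto simp: F_def)
  then show ?thesis using that[of k] \<tau>'(3) AP P_closed by simp
qed

text \<open>Carries positivity from the trace pairing over to vector states: on \<open>A\<close> a
  vector state is \<open>\<tau> (k * a)\<close> for some \<open>k\<close>, so trace bounds on the
  exponentials bound it too.\<close>

lemma positive_op_if_tau_positive:
  assumes A: "fd_von_neumann_algebra A" "A \<subseteq> P" and z: "z \<in> A" and herm: "adj z = z"
    and pos: "\<And>a. a \<in> A \<Longrightarrow> 0 \<le> Re (\<tau> (adj a * a * z))"
  shows "positive_op z"
proof -
  have vNA: "von_neumann_algebra A" using A by (simp add: fd_von_neumann_algebra_def)
  note A_closed = vN_closed[OF vNA]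
  have AP: "x \<in> P" if "x \<in> A" for x using that A by blast
  obtain \<tau>' where \<tau>': "bounded_linear \<tau>'" "\<And>c x. \<tau>' (c *\<^sub>C x) = c * \<tau>' x"
    "\<And>x. x \<in> P \<Longrightarrow> \<tau>' x = \<tau> x"
    by (rule tau_bounded_extension) blast
  define e where "e = (\<lambda>s::real. exp (s *\<^sub>R (- z)))"
  have eA: "e s \<in> A" for s unfolding e_def using z A_closed by simp
  have e_adj: "adj (e s) = e s" for s
    by (simp add: e_def adj_exp adj_scaleR herm adj_uminus)
  have e_sq: "e (s / 2) * e (s / 2) = e s" for s
    using exp_add_commuting[of "(s/2) *\<^sub>R (- z)" "(s/2) *\<^sub>R (- z)"]
      scaleR_add_left[of "s/2" "s/2" "- z"]
    by (simp add: e_def)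
  have e_comm: "e s * z = z * e s" for s
    unfolding e_def by (rule exp_commute) simp
  have e_deriv: "(e has_vector_derivative - (e s * z)) (at s)" for s
    using exp_scaleR_has_vector_derivative_right[of "- z" s UNIV] by (simp add: e_def)
  have Re_deriv: "((\<lambda>s. Re (f (e s))) has_real_derivative - Re (f (e s * z))) (at s)"
    if "bounded_linear f" for f s
  proof -
    have "bounded_linear (\<lambda>x. Re (f x))"
      by (rule bounded_linear_compose[OF bounded_linear_Re that])
    from bounded_linear.has_vector_derivative[OF this e_deriv[of s]]
    show ?thesis
      using that by (simp add: has_real_derivative_iff_has_vector_derivative linear_simps)
  qed
  \<comment> \<open>The derivative is minus the trace of \<open>e r * z\<close>, and
    \<open>e r\<close> is \<open>adj a * a\<close> for \<open>a = e (r/2)\<close>, so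
    \<open>pos\<close> applies. The starting value is \<open>\<tau> 1 = 1\<close>.\<close>
  have tau_e: "Re (\<tau> (e s)) \<le> 1" if "s \<ge> 0" for s
  proof -
    have "Re (\<tau>' (e s)) \<le> Re (\<tau>' (e 0))"
    proof (rule DERIV_nonpos_imp_nonincreasing[OF that])
      fix r
      have "e r * z \<in> P" by (intro AP A_closed eA z)
      then have "0 \<le> Re (\<tau>' (e r * z))"
        using pos[OF eA, of "r/2"] by (simp add: e_adj e_sq \<tau>'(3))
      then show "\<exists>y. ((\<lambda>s. Re (\<tau>' (e s))) has_real_derivative y) (at r) \<and> y \<le> 0"
        using Re_deriv[OF \<tau>'(1), of r] by (intro exI conjI) auto
    qed
    then show ?thesis using eA AP tau_one P_closed by (simp add: \<tau>'(3) e_def)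
  qed
  have "0 \<le> Re (cinner (op_apply z h) h)" for h
  proof -
    define \<omega> where "\<omega> = (\<lambda>T. cinner (op_apply T h) h)"
    have \<omega>: "bounded_linear \<omega>"
      unfolding \<omega>_def by (rule bounded_linear_compose[OF bounded_linear_cinner_left bounded_linear_op_apply_left])
    have \<omega>z: "bounded_linear (\<lambda>T. \<omega> (T * z))"
      by (rule bounded_linear_compose[OF \<omega> bounded_linear_mult_left])
    have "clinear_on A \<omega>"
      by (simp add: clinear_on_def \<omega>_def op_apply_simps cinner_add_left cinner_scaleC_left scaleC_complex_def)
    then obtain k where k: "k \<in> A" "\<And>a. a \<in> A \<Longrightarrow> \<omega> a = \<tau> (k * a)"
      by (rule tau_representation[OF A]) blast
    \<comment> \<open>Expands positivity of the trace at \<open>adj k - e s\<close>; the quadratic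
      term is \<open>e (2 * s)\<close>, controlled by \<open>tau_e\<close>.\<close>
    have bound: "2 * Re (\<omega> (e s)) \<le> Re (\<tau> (k * adj k)) + 1" if "s \<ge> 0" for s
    proof -
      note closed = k(1) eA[of s] A_closed AP
      have "0 \<le> Re (\<tau> (adj (adj k - e s) * (adj k - e s)))"
        using tau_pos[of "adj k - e s"] closed by (simp add: complex_nonneg_Reals_iff)
      also have "adj (adj k - e s) * (adj k - e s)
          = (k * adj k + e s * e s) - (k * e s + adj (k * e s))"
        by (simp add: adj_diff adj_mult e_adj algebra_simps)
      also have "\<tau> \<dots> = \<tau> (k * adj k) + \<tau> (e s * e s) - (\<tau> (k * e s) + cnj (\<tau> (k * e s)))"
        using closed P_closed by (simp add: tau_diff tau_add tau_adj)
      also have "e s * e s = e (2 * s)" using e_sq[of "2 * s"] by simp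
      finally show ?thesis using k(2)[OF eA[of s]] tau_e[of "2 * s"] that by simp
    qed
    define m where "m = Re (\<omega> z)"
    \<comment> \<open>The derivative is minus the squared norm of \<open>e (r/2) * z\<close> applied
      to \<open>h\<close>; this is the convexity of the real part of \<open>\<omega> (e s)\<close>
      in \<open>s\<close>.\<close>
    have mono: "Re (\<omega> (e s * z)) \<le> m" if "s \<ge> 0" for s
    proof -
      have "Re (\<omega> (e s * z)) \<le> Re (\<omega> (e 0 * z))"
      proof (rule DERIV_nonpos_imp_nonincreasing[OF that])
        fix r
        have "e r * z * z = e (r/2) * (e (r/2) * z) * z" by (simp add: e_sq flip: mult.assoc)
        also have "\<dots> = e (r/2) * (z * e (r/2)) * z" by (simp only: e_comm)
        also have "\<dots> = (e (r/2) * z) * (e (r/2) * z)" by (simp only: mult.assoc)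
        also have "\<dots> = adj (e (r/2) * z) * (e (r/2) * z)" by (simp add: adj_mult herm e_adj e_comm)
        finally have "0 \<le> Re (\<omega> (e r * z * z))"
          by (simp add: \<omega>_def op_apply_simps cinner_adj_left cinner_self)
        then show "\<exists>y. ((\<lambda>s. Re (\<omega> (e s * z))) has_real_derivative y) (at r) \<and> y \<le> 0"
          using Re_deriv[OF \<omega>z, of r] by (intro exI conjI) auto
      qed
      then show ?thesis by (simp add: m_def e_def)
    qed
    \<comment> \<open>The convex function lies above its tangent at 0, whose slope is
      \<open>- m\<close>.\<close>
    have lower: "Re (\<omega> 1) \<le> Re (\<omega> (e s)) + s * m" if "s \<ge> 0" for s
    proof -
      have "Re (\<omega> (e 0)) + 0 * m \<le> Re (\<omega> (e s)) + s * m"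
      proof (rule DERIV_nonneg_imp_nondecreasing[OF that])
        fix r :: real assume "0 \<le> r"
        have "((\<lambda>s. Re (\<omega> (e s)) + s * m) has_real_derivative - Re (\<omega> (e r * z)) + m) (at r)"
          by (rule DERIV_add[OF Re_deriv[OF \<omega>]]) (auto intro!: derivative_eq_intros)
        then show "\<exists>y. ((\<lambda>s. Re (\<omega> (e s)) + s * m) has_real_derivative y) (at r) \<and> 0 \<le> y"
          using mono[OF \<open>0 \<le> r\<close>] by (intro exI conjI) auto
      qed
      then show ?thesis by (simp add: e_def)
    qed
    have "0 \<le> m"
    proof (rule ccontr)
      assume "\<not> 0 \<le> m"
      \<comment> \<open>\<open>bound\<close> and \<open>lower\<close> together give
        \<open>- (s * m) \<le> K\<close> for all nonnegative \<open>s\<close>; the next line picks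
        the \<open>s\<close> for which the left side is \<open>\<bar>K\<bar> + 1\<close>.\<close>
      define K where "K = (Re (\<tau> (k * adj k)) + 1) / 2 - Re (\<omega> 1)"
      define s where "s = (\<bar>K\<bar> + 1) / (- m)"
      have "s \<ge> 0" unfolding s_def using \<open>\<not> 0 \<le> m\<close> by (intro divide_nonneg_pos) auto
      then have "- (s * m) \<le> K" using bound[of s] lower[of s] by (simp add: K_def field_simps)
      moreover have "- (s * m) = \<bar>K\<bar> + 1" using \<open>\<not> 0 \<le> m\<close> by (simp add: s_def)
      ultimately show False by simp
    qed
    then show ?thesis by (simp add: m_def \<omega>_def)
  qed
  moreover have "Im (cinner (op_apply z h) h) = 0" for h
  proof -
    have "cinner (op_apply z h) h = cinner h (op_apply z h)" using cinner_adj_left[of z h h] herm by simp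
    also have "\<dots> = cnj (cinner (op_apply z h) h)" by (rule cinner_commute)
    finally show ?thesis by (simp add: complex_eq_iff)
  qed
  ultimately show ?thesis by (simp add: positive_op_def complex_nonneg_Reals_iff)
qed

text \<open>\<open>tau_representation\<close> applied to the functional sending \<open>b\<close> to
  \<open>\<tau> (b * x)\<close> produces the value at \<open>x\<close>. The second claim is the test
  by which values of conditional expectations are identified from here on.\<close>

lemma cond_exp_exists:
  assumes A: "fd_von_neumann_algebra A" "A \<subseteq> P"
  shows "trace_preserving_cond_exp P \<tau> A (cond_exp P \<tau> A)"
    and "\<And>x a. x \<in> P \<Longrightarrow> a \<in> A \<Longrightarrow> (\<And>b. b \<in> A \<Longrightarrow> \<tau> (b * a) = \<tau> (b * x)) \<Longrightarrow> cond_exp P \<tau> A x = a"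
proof -
  have vNA: "von_neumann_algebra A" using A by (simp add: fd_von_neumann_algebra_def)
  note A_closed = vN_closed[OF vNA]
  have AP: "x \<in> P" if "x \<in> A" for x using that A by blast
  \<comment> \<open>Testing with \<open>b = adj (a - a')\<close> reduces equality to
    faithfulness.\<close>
  have unique: "a = a'"
    if "a \<in> A" "a' \<in> A" and eq: "\<And>b. b \<in> A \<Longrightarrow> \<tau> (b * a) = \<tau> (b * a')" for a a'
  proof -
    have "\<tau> (adj (a - a') * (a - a')) = 0"
      using eq[of "adj (a - a')"] that(1,2) A_closed AP P_closed
      by (simp add: tau_diff right_diff_distrib)
    then show ?thesis using tau_faithful[of "a - a'"] that AP P_closed by simp
  qed
  have "\<exists>a\<in>A. \<forall>b\<in>A. \<tau> (b * a) = \<tau> (b * x)" if "x \<in> P" for x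
  proof -
    have "clinear_on A (\<lambda>b. \<tau> (b * x))"
      using that AP P_closed
      by (simp add: clinear_on_def distrib_right tau_add mult_scaleC_left tau_scaleC scaleC_complex_def)
    then obtain a where "a \<in> A" "\<And>b. b \<in> A \<Longrightarrow> \<tau> (b * x) = \<tau> (a * b)"
      by (rule tau_representation[OF A]) blast
    then show ?thesis using tau_comm AP by metis
  qed
  then obtain E0 where E0: "\<And>x. x \<in> P \<Longrightarrow> E0 x \<in> A"
    "\<And>x b. x \<in> P \<Longrightarrow> b \<in> A \<Longrightarrow> \<tau> (b * E0 x) = \<tau> (b * x)"
    by metis
  have E0_eq: "E0 x = a" if "x \<in> P" "a \<in> A" "\<And>b. b \<in> A \<Longrightarrow> \<tau> (b * a) = \<tau> (b * x)" for x a
    using that E0 by (intro unique) auto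
  \<comment> \<open>Restriction to \<open>P\<close> supplies the extensionality that makes the map
    unique as a function.\<close>
  define E where "E = restrict E0 P"
  have E: "trace_preserving_cond_exp P \<tau> A E"
    unfolding trace_preserving_cond_exp_def
  proof (intro conjI ballI)
    show "E \<in> P \<rightarrow>\<^sub>E A" by (simp add: E_def E0)
    show "clinear_on P E"
      unfolding clinear_on_def
    proof (intro conjI ballI allI)
      fix x y assume "x \<in> P" "y \<in> P"
      then have "E0 (x + y) = E0 x + E0 y"
        by (intro E0_eq) (simp_all add: distrib_left tau_add E0 AP A_closed P_closed)
      with \<open>x \<in> P\<close> \<open>y \<in> P\<close> show "E (x + y) = E x + E y" by (simp add: E_def P_closed)
    next
      fix x c assume "x \<in> P"
      then have "E0 (c *\<^sub>C x) = c *\<^sub>C E0 x"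
        by (intro E0_eq) (simp_all add: mult_scaleC_right tau_scaleC E0 AP A_closed P_closed)
      with \<open>x \<in> P\<close> show "E (c *\<^sub>C x) = c *\<^sub>C E x" by (simp add: E_def P_closed)
    qed
    show "E a = a" if "a \<in> A" for a
      using that AP by (simp add: E_def E0_eq)
    show "E (a * x * b) = a * E x * b" if "a \<in> A" "b \<in> A" "x \<in> P" for a b x
    proof -
      have "E0 (a * x * b) = a * E0 x * b"
      proof (rule E0_eq)
        fix c assume c: "c \<in> A"
        \<comment> \<open>Cyclicity brings \<open>b\<close> to the front, so that an element of
          \<open>A\<close> stands to the left of \<open>E0 x\<close>.\<close>
        have "\<tau> (c * (a * E0 x * b)) = \<tau> ((b * (c * a)) * E0 x)"
          using tau_comm[of "c * a * E0 x" b] that c AP E0 P_closed by (simp add: mult.assoc)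
        also have "\<dots> = \<tau> ((b * (c * a)) * x)" using that c A_closed by (simp add: E0)
        also have "\<dots> = \<tau> (c * (a * x * b))"
          using tau_comm[of "c * a * x" b] that c AP P_closed by (simp add: mult.assoc)
        finally show "\<tau> (c * (a * E0 x * b)) = \<tau> (c * (a * x * b))" .
      qed (use that AP E0 A_closed P_closed in auto)
      then show ?thesis using that AP P_closed by (simp add: E_def)
    qed
    show "\<tau> (E x) = \<tau> x" if "x \<in> P" for x
      using E0(2)[OF that, of 1] that A_closed by (simp add: E_def)
    show "positive_op (E (adj x * x))" if x: "x \<in> P" for x
    proof -
      define z where "z = E0 (adj x * x)"
      have xx: "adj x * x \<in> P" using x P_closed by simp
      have zA: "z \<in> A" using E0 xx by (simp add: z_def)
      have z: "\<tau> (b * z) = \<tau> (b * (adj x * x))" if "b \<in> A" for b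
        unfolding z_def using E0 xx that by blast
      \<comment> \<open>\<open>adj z\<close> has the same pairings with \<open>A\<close> as the
        hermitian element \<open>adj x * x\<close>, so it equals \<open>z\<close>.\<close>
      have "z = adj z"
        unfolding z_def
      proof (rule E0_eq[OF xx], fold z_def)
        show "adj z \<in> A" using zA A_closed by simp
        fix b assume b: "b \<in> A"
        have "\<tau> (b * adj z) = cnj (\<tau> (z * adj b))"
          using tau_adj[of "z * adj b"] b zA AP P_closed by (simp add: adj_mult)
        also have "\<tau> (z * adj b) = \<tau> (adj b * z)" using tau_comm[of z "adj b"] b zA AP P_closed by simp
        also have "\<dots> = \<tau> (adj b * (adj x * x))" using z b A_closed by simp
        also have "cnj \<dots> = \<tau> ((adj x * x) * b)"
          using tau_adj[of "adj b * (adj x * x)"] b AP xx P_closed by (simp add: adj_mult)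
        also have "\<dots> = \<tau> (b * (adj x * x))" using tau_comm[OF xx AP[OF b]] by simp
        finally show "\<tau> (b * adj z) = \<tau> (b * (adj x * x))" .
      qed
      \<comment> \<open>By cyclicity this trace is that of \<open>adj w * w\<close> with
        \<open>w = x * adj a\<close>.\<close>
      moreover have "0 \<le> Re (\<tau> (adj a * a * z))" if a: "a \<in> A" for a
      proof -
        have "\<tau> (adj a * a * z) = \<tau> (adj a * (a * (adj x * x)))"
          using z[of "adj a * a"] a A_closed by (simp add: mult.assoc)
        also have "\<dots> = \<tau> (adj (x * adj a) * (x * adj a))"
          using tau_comm[of "adj a" "a * (adj x * x)"] a x AP P_closed by (simp add: adj_mult mult.assoc)
        finally show ?thesis
          using tau_pos[of "x * adj a"] a x AP P_closed by (simp add: complex_nonneg_Reals_iff)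
      qed
      ultimately have "positive_op z" using positive_op_if_tau_positive[OF A zA] by simp
      then show ?thesis using xx by (simp add: E_def z_def)
    qed
  qed
  have E_unique: "E' = E" if E': "trace_preserving_cond_exp P \<tau> A E'" for E'
  proof (rule PiE_ext[where k = P and s = "\<lambda>_. A"])
    show "E' \<in> P \<rightarrow>\<^sub>E A" "E \<in> P \<rightarrow>\<^sub>E A"
      using E E' by (simp_all add: trace_preserving_cond_exp_def)
    fix x assume x: "x \<in> P"
    have E'A: "E' x \<in> A" using E' x by (auto simp: trace_preserving_cond_exp_def)
    have "\<tau> (b * E' x) = \<tau> (b * x)" if b: "b \<in> A" for b
    proof -
      \<comment> \<open>The factor \<open>1\<close> specialises the two-sided module property to the
        left; trace preservation then gives the pairing that determines \<open>E' x\<close>.\<close>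
      have "E' (b * x * 1) = b * E' x * 1"
        using E' x b vN_one[OF vNA] unfolding trace_preserving_cond_exp_def by blast
      moreover have "\<tau> (E' (b * x)) = \<tau> (b * x)"
        using E' P_closed(5)[OF AP[OF b] x] unfolding trace_preserving_cond_exp_def by blast
      ultimately show ?thesis by simp
    qed
    then show "E' x = E x" using E0_eq[OF x E'A] x by (simp add: E_def)
  qed
  have "cond_exp P \<tau> A = E"
    unfolding cond_exp_def using E E_unique by (rule the_equality)
  then show "trace_preserving_cond_exp P \<tau> A (cond_exp P \<tau> A)"
    and "\<And>x a. x \<in> P \<Longrightarrow> a \<in> A \<Longrightarrow> (\<And>b. b \<in> A \<Longrightarrow> \<tau> (b * a) = \<tau> (b * x)) \<Longrightarrow> cond_exp P \<tau> A x = a"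
    using E E0_eq by (simp_all add: E_def)
qed

lemma cond_exp_in:
  assumes "fd_von_neumann_algebra A" "A \<subseteq> P" "x \<in> P"
  shows "cond_exp P \<tau> A x \<in> A"
  using cond_exp_exists(1)[OF assms(1,2)] assms(3) by (auto simp: trace_preserving_cond_exp_def)

text \<open>The module property takes \<open>b\<close> inside the expectation, and trace
  preservation then removes the expectation.\<close>

lemma tau_mult_cond_exp:
  assumes A: "fd_von_neumann_algebra A" "A \<subseteq> P" and x: "x \<in> P" and b: "b \<in> A"
  shows "\<tau> (b * cond_exp P \<tau> A x) = \<tau> (b * x)"
proof -
  note E = cond_exp_exists(1)[OF A, unfolded trace_preserving_cond_exp_def]
  have vNA: "von_neumann_algebra A" using A by (simp add: fd_von_neumann_algebra_def)
  have "cond_exp P \<tau> A (b * x * 1) = b * cond_exp P \<tau> A x * 1"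
    using E x b vN_one[OF vNA] by blast
  moreover have "\<tau> (cond_exp P \<tau> A (b * x)) = \<tau> (b * x)"
    using E P_closed(5)[OF _ x, of b] b A by blast
  ultimately show ?thesis by simp
qed

end

section \<open>Conjugation by unitaries\<close>

lemma commutant_conj:
  assumes UV: "U * V = 1" and VU: "V * U = 1"
  shows "commutant ((\<lambda>y. V * y * U) ` S) = (\<lambda>y. V * y * U) ` commutant S"
proof (intro subset_antisym subsetI)
  have cancel: "U * (V * y) = y" "V * (U * y) = y" for y
    using UV VU by (simp_all flip: mult.assoc)
  {
    fix a assume a: "a \<in> commutant ((\<lambda>y. V * y * U) ` S)"
    have "U * a * V * b = b * (U * a * V)" if "b \<in> S" for b
    proof -
      have "U * a * V * b = U * (a * (V * b * U)) * V"
        by (simp add: mult.assoc UV)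
      also have "a * (V * b * U) = V * b * U * a"
        using a that by (auto simp: commutant_def)
      finally show ?thesis by (simp add: mult.assoc cancel)
    qed
    then have "U * a * V \<in> commutant S" by (simp add: commutant_def)
    moreover have "a = V * (U * a * V) * U" by (simp add: mult.assoc cancel VU)
    ultimately show "a \<in> (\<lambda>y. V * y * U) ` commutant S" by blast
  next
    fix a assume "a \<in> (\<lambda>y. V * y * U) ` commutant S"
    then obtain y where y: "a = V * y * U" "\<And>b. b \<in> S \<Longrightarrow> y * b = b * y"
      by (auto simp: commutant_def)
    have "V * y * U * (V * b * U) = V * b * U * (V * y * U)" if "b \<in> S" for b
    proof -
      have "V * y * U * (V * b * U) = V * (y * b) * U" by (simp add: mult.assoc cancel)
      also have "\<dots> = V * b * U * (V * y * U)" using y(2)[OF that] by (simp add: mult.assoc cancel)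
      finally show ?thesis .
    qed
    then show "a \<in> commutant ((\<lambda>y. V * y * U) ` S)" by (auto simp: commutant_def y(1))
  }
qed

text \<open>Conjugation by a unitary is linear, respects adjoints and commutes with taking
  commutants, so the bicommutant condition and a finite spanning set are carried along.\<close>

lemma fd_von_neumann_algebra_conj:
  assumes A: "fd_von_neumann_algebra A" and UV: "U * adj U = 1" and VU: "adj U * U = 1"
  shows "fd_von_neumann_algebra ((\<lambda>y. adj U * y * U) ` A)"
proof -
  let ?f = "\<lambda>y. adj U * y * U"
  have vN: "von_neumann_algebra A" using A by (simp add: fd_von_neumann_algebra_def)
  obtain B where B: "finite B" "complex_span B = A"
    using A by (auto simp: fd_von_neumann_algebra_def)
  have "commutant (commutant (?f ` A)) = ?f ` A"
    using vN by (simp add: commutant_conj[OF UV VU] von_neumann_algebra_def)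
  moreover have "adj a \<in> ?f ` A" if "a \<in> ?f ` A" for a
    using that vN_adj[OF vN] by (auto simp: adj_mult mult.assoc)
  moreover have "complex_span (?f ` B) = ?f ` A"
  proof -
    have "Vector_Spaces.linear scaleC scaleC ?f"
      by unfold_locales
        (simp_all add: distrib_left distrib_right mult_scaleC_left mult_scaleC_right)
    then interpret lin: Vector_Spaces.linear scaleC scaleC ?f .
    show ?thesis using lin.span_image[of B] B(2) by (simp add: complex_span_def)
  qed
  ultimately show ?thesis
    using B(1) by (auto simp: fd_von_neumann_algebra_def von_neumann_algebra_def)
qed

section \<open>Series expansion of a conjugated element\<close>

lemma scaleC_power: "(c *\<^sub>C T) ^ n = c ^ n *\<^sub>C T ^ n" for T :: "'h::complex_hilbert_space bounded_op"
  by (induction n) (simp_all add: mult_scaleC_left mult_scaleC_right scaleC_scaleC)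

lemma power_mult_distrib_commuting:
  fixes p q :: "'a::monoid_mult"
  assumes "p * q = q * p"
  shows "(p * q) ^ n = p ^ n * q ^ n"
proof (induction n)
  case (Suc n)
  have "(p * q) ^ Suc n = p * (q * p ^ n) * q ^ n" by (simp add: Suc mult.assoc)
  also have "q * p ^ n = p ^ n * q"
    using power_commuting_commutes[of p q n] assms by simp
  finally show ?case by (simp add: mult.assoc)
qed simp

text \<open>Cauchy product of two absolutely convergent series, with \<open>y\<close> absorbed into
  the first. Grouping by total degree \<open>k\<close> lets each degree cancel separately.\<close>

lemma exp_conj_sums:
  fixes X y :: "'a::{real_normed_algebra_1,banach}"
  shows "(\<lambda>k. \<Sum>i\<le>k. ((- X) ^ i /\<^sub>R fact i * y) * (X ^ (k - i) /\<^sub>R fact (k - i)))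
    sums (exp (- X) * y * exp X)"
proof -
  have 1: "summable (\<lambda>i. norm ((- X) ^ i /\<^sub>R fact i * y))"
    by (rule summable_comparison_test'[OF summable_mult2[OF summable_norm_exp[of "- X"], of "norm y"]])
      (simp add: norm_mult_ineq del: norm_scaleR mult_scaleR_left)
  have "(\<lambda>i. (- X) ^ i /\<^sub>R fact i * y) sums (exp (- X) * y)"
    by (rule bounded_linear.sums[OF bounded_linear_mult_left exp_converges])
  then show ?thesis
    using Cauchy_product_sums[OF 1 summable_norm_exp[of X]]
    by (simp add: sums_iff exp_def)
qed

text \<open>Up to the factor \<open>fact k\<close> this is the binomial expansion of the
  \<open>k\<close>-th power of \<open>1 - 1\<close>.\<close>

lemma alternating_fact_sum:
  assumes "k > 0"
  shows "(\<Sum>i\<le>k. (- 1) ^ i / (fact i * fact (k - i))) = (0::complex)"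
proof -
  have "(\<Sum>i\<le>k. (- 1) ^ i / (fact i * fact (k - i)))
      = (\<Sum>i\<le>k. (- 1) ^ i * of_nat (k choose i)) / (fact k :: complex)"
    unfolding sum_divide_distrib by (rule sum.cong) (auto simp: binomial_fact)
  then show ?thesis using choose_alternating_sum[OF assms, where 'a = complex] by simp
qed

section \<open>Trace identities in a commuting square\<close>

context traced_algebra
begin

context
  fixes P1 Q1 Q0 p q
  assumes cs: "commuting_square P1 P Q1 Q0 \<tau>"
    and p: "p \<in> commutant Q1" "p \<in> P1" and q: "q \<in> commutant Q1" "q \<in> Q0"
    and pq: "p * q = q * p"
begin

lemma cs_fd: "fd_von_neumann_algebra P1" "fd_von_neumann_algebra Q1" "fd_von_neumann_algebra Q0"
  and cs_sub: "Q1 \<subseteq> P1" "P1 \<subseteq> P" "Q1 \<subseteq> Q0" "Q0 \<subseteq> P" "Q1 \<subseteq> P"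
  and cs_exp: "x \<in> P \<Longrightarrow> cond_exp P \<tau> P1 (cond_exp P \<tau> Q0 x) = cond_exp P \<tau> Q1 x"
  using cs by (auto simp: commuting_square_def)

lemma cs_vN: "von_neumann_algebra P1" "von_neumann_algebra Q1" "von_neumann_algebra Q0"
  using cs_fd by (simp_all add: fd_von_neumann_algebra_def)

lemmas P1_closed = vN_closed[OF cs_vN(1)]
lemmas Q0_closed = vN_closed[OF cs_vN(3)]

abbreviation "E \<equiv> cond_exp P \<tau> Q1"

lemma E_in: "x \<in> P \<Longrightarrow> E x \<in> Q1"
  by (rule cond_exp_in[OF cs_fd(2) cs_sub(5)])

lemma tau_mult_E: "b \<in> Q1 \<Longrightarrow> x \<in> P \<Longrightarrow> \<tau> (b * E x) = \<tau> (b * x)"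
  by (rule tau_mult_cond_exp[OF cs_fd(2) cs_sub(5)])

text \<open>\<open>y\<close> is fixed by the expectation onto \<open>Q0\<close>, so the commuting
  relation says that its expectation onto \<open>P1\<close> is already \<open>E y\<close>.\<close>

lemma tau_orth:
  assumes "x \<in> P1" "y \<in> Q0"
  shows "\<tau> (x * y) = \<tau> (x * E y)"
proof -
  have yP: "y \<in> P" using assms cs_sub by blast
  have "cond_exp P \<tau> Q0 y = y"
    using cond_exp_exists(1)[OF cs_fd(3) cs_sub(4)] assms(2)
    by (simp add: trace_preserving_cond_exp_def)
  then have "E y = cond_exp P \<tau> P1 y" using cs_exp[OF yP] by simp
  then show ?thesis using tau_mult_cond_exp[OF cs_fd(1) cs_sub(2) yP assms(1)] by simp
qed

text \<open>Tested against \<open>b\<close> in \<open>Q1\<close>, the right factor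
  \<open>q ^ j\<close> travels around the trace, passes \<open>b\<close> because they commute, and
  joins \<open>q ^ i\<close>.\<close>

lemma E_power_move:
  assumes "y \<in> Q0"
  shows "E (q ^ i * y * q ^ j) = E (q ^ (i + j) * y)"
proof (rule cond_exp_exists(2)[OF cs_fd(2) cs_sub(5)])
  have yP: "y \<in> P" and qP: "q \<in> P" using assms q cs_sub by blast+
  show "q ^ i * y * q ^ j \<in> P" "E (q ^ (i + j) * y) \<in> Q1"
    using yP qP by (simp_all add: P_closed E_in)
  fix b assume b: "b \<in> Q1"
  then have bP: "b \<in> P" using cs_sub by blast
  have "b * q = q * b" using q b by (simp add: commutant_def)
  then have comm: "b * q ^ j = q ^ j * b" by (metis power_commuting_commutes)
  have "\<tau> (b * (q ^ i * y * q ^ j)) = \<tau> (q ^ j * b * q ^ i * y)"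
    using tau_comm[of "b * q ^ i * y" "q ^ j"] yP qP bP by (simp add: P_closed mult.assoc)
  also have "q ^ j * b * q ^ i * y = b * (q ^ (i + j) * y)"
    unfolding comm[symmetric] by (simp add: power_add add.commute[of i] mult.assoc)
  also have "\<tau> (b * (q ^ (i + j) * y)) = \<tau> (b * E (q ^ (i + j) * y))"
    using tau_mult_E[OF b] yP qP by (simp add: P_closed)
  finally show "\<tau> (b * E (q ^ (i + j) * y)) = \<tau> (b * (q ^ i * y * q ^ j))" by simp
qed

text \<open>The value depends on i + j only; this is what makes the alternating sum in the expansion of
  the conjugated element collapse.\<close>

lemma tau_power_move:
  assumes x: "x \<in> P1" and y: "y \<in> Q0"
  shows "\<tau> (x * ((p * q) ^ i * y * (p * q) ^ j)) = \<tau> (x * p ^ (i + j) * E (q ^ (i + j) * y))"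
proof -
  have inP: "x \<in> P" "y \<in> P" "p \<in> P" "q \<in> P" using x y p q cs_sub by blast+
  define e where "e = E (q ^ (i + j) * y)"
  have eQ: "e \<in> Q1" unfolding e_def using inP by (simp add: P_closed E_in)
  then have eP: "e \<in> P" using cs_sub by blast
  have "p * e = e * p" using p eQ by (simp add: commutant_def)
  then have comm: "e * p ^ j = p ^ j * e" using power_commuting_commutes[of p e j] by simp
  \<comment> \<open>The right-hand power is written with \<open>q\<close> first and the left-hand
    one with \<open>p\<close> first, so the powers of \<open>q\<close> sit next to \<open>y\<close>
    and those of \<open>p\<close> stay outside.\<close>
  have "(p * q) ^ j = q ^ j * p ^ j"
    using power_mult_distrib_commuting[of q p j] pq by simp
  moreover have "(p * q) ^ i = p ^ i * q ^ i"
    by (rule power_mult_distrib_commuting[OF pq])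
  ultimately have "\<tau> (x * ((p * q) ^ i * y * (p * q) ^ j))
      = \<tau> ((x * p ^ i * (q ^ i * y * q ^ j)) * p ^ j)"
    by (simp add: mult.assoc)
  also have "\<dots> = \<tau> (p ^ j * (x * p ^ i * (q ^ i * y * q ^ j)))"
    by (rule tau_comm) (simp_all add: inP P_closed)
  also have "\<dots> = \<tau> ((p ^ j * x * p ^ i) * (q ^ i * y * q ^ j))" by (simp add: mult.assoc)
  \<comment> \<open>The factors now lie in \<open>P1\<close> and \<open>Q0\<close>, so
    \<open>tau_orth\<close> applies, and \<open>E_power_move\<close> identifies the expectation as
    \<open>e\<close>.\<close>
  also have "\<dots> = \<tau> ((p ^ j * x * p ^ i) * e)"
    unfolding e_def E_power_move[OF y, symmetric]
    by (rule tau_orth) (use x y p q in \<open>simp_all add: P1_closed Q0_closed\<close>)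
  \<comment> \<open>\<open>p ^ j\<close> goes back around the trace and past \<open>e\<close>, with
    which it commutes because \<open>e\<close> lies in \<open>Q1\<close>.\<close>
  also have "\<dots> = \<tau> (p ^ j * (x * p ^ i * e))" by (simp add: mult.assoc)
  also have "\<dots> = \<tau> ((x * p ^ i * e) * p ^ j)"
    by (rule tau_comm) (simp_all add: inP eP P_closed)
  also have "\<dots> = \<tau> (x * p ^ (i + j) * e)" by (simp add: mult.assoc comm power_add)
  finally show ?thesis by (simp add: e_def)
qed

lemma tau_exp_conj:
  assumes x: "x \<in> P1" and y: "y \<in> Q0" and X: "X = c *\<^sub>C (p * q)"
  shows "\<tau> (x * (exp (- X) * y * exp X)) = \<tau> (x * E y)"
proof -
  have inP: "x \<in> P" "y \<in> P" "p \<in> P" "q \<in> P" using x y p q cs_sub by blast+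
  then have XP: "X \<in> P" by (simp add: X P_closed)
  obtain \<tau>' where \<tau>': "bounded_linear \<tau>'" "\<And>c x. \<tau>' (c *\<^sub>C x) = c * \<tau>' x"
    "\<And>x. x \<in> P \<Longrightarrow> \<tau>' x = \<tau> x"
    by (rule tau_bounded_extension) blast
  define f where "f = (\<lambda>z. \<tau>' (x * z))"
  have f: "bounded_linear f"
    unfolding f_def by (rule bounded_linear_compose[OF \<tau>'(1) bounded_linear_mult_right])
  let ?t = "\<lambda>i j. ((- X) ^ i /\<^sub>R fact i * y) * (X ^ j /\<^sub>R fact j)"
  define T where "T = (\<lambda>k. \<tau> (x * p ^ k * E (q ^ k * y)))"
  \<comment> \<open>Apart from the sign and the factorials, the term depends only on the degree
    \<open>i + j\<close>.\<close>
  have term_eq: "f (?t i j) = (- 1) ^ i / (fact i * fact j) * (c ^ (i + j) * T (i + j))" for i j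
  proof -
    have "(- X) ^ i = (- c) ^ i *\<^sub>C (p * q) ^ i" "X ^ j = c ^ j *\<^sub>C (p * q) ^ j"
      using scaleC_power[of "- c" "p * q" i] by (simp_all add: X scaleC_power)
    then have "x * ?t i j = ((- c) ^ i * c ^ j / (fact i * fact j)) *\<^sub>C (x * ((p * q) ^ i * y * (p * q) ^ j))"
      unfolding scaleC_of_real[symmetric]
      by (simp add: mult_scaleC_left mult_scaleC_right scaleC_scaleC divide_inverse mult_ac)
    moreover have "x * ((p * q) ^ i * y * (p * q) ^ j) \<in> P" by (simp add: inP P_closed)
    ultimately have "f (?t i j) = (- c) ^ i * c ^ j / (fact i * fact j) * T (i + j)"
      by (simp add: f_def \<tau>' T_def tau_power_move[OF x y])
    also have "(- c) ^ i = (- 1) ^ i * c ^ i" by (rule power_minus)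
    finally show ?thesis by (simp add: power_add mult_ac)
  qed
  \<comment> \<open>For positive \<open>k\<close> the common factor \<open>c ^ k * T k\<close>
    multiplies a vanishing alternating sum; degree 0 is a single term, equal to
    \<open>T 0\<close>.\<close>
  have "f (\<Sum>i\<le>k. ?t i (k - i)) = (if k = 0 then T 0 else 0)" for k
  proof -
    have "f (\<Sum>i\<le>k. ?t i (k - i)) = (\<Sum>i\<le>k. f (?t i (k - i)))"
      using f by (simp add: linear_sum bounded_linear.linear)
    also have "\<dots> = (\<Sum>i\<le>k. (- 1) ^ i / (fact i * fact (k - i)) * (c ^ k * T k))"
      by (rule sum.cong[OF refl]) (subst term_eq, simp)
    also have "\<dots> = (\<Sum>i\<le>k. (- 1) ^ i / (fact i * fact (k - i))) * (c ^ k * T k)"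
      by (simp add: sum_distrib_right)
    finally show ?thesis using alternating_fact_sum[of k] by (cases "k = 0") simp_all
  qed
  then have "(\<lambda>k. if k = 0 then T 0 else 0) sums f (exp (- X) * y * exp X)"
    using bounded_linear.sums[OF f exp_conj_sums[of X y]] by simp
  moreover have "(\<lambda>k. if k = 0 then T 0 else 0) sums T 0"
    using sums_single[of 0 "\<lambda>_. T 0"] by simp
  ultimately have "f (exp (- X) * y * exp X) = T 0" using sums_unique2 by blast
  then show ?thesis using \<tau>'(3) inP XP by (simp add: f_def T_def P_closed)
qed

lemma commuting_square_conj:
  assumes X: "X = c *\<^sub>C (p * q)" and skew: "adj X = - X"
  shows "commuting_square P1 P Q1 {adj (exp X) * y * exp X |y. y \<in> Q0} \<tau>"
proof -
  let ?A = "(\<lambda>y. adj (exp X) * y * exp X) ` Q0"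
  have adjU: "adj (exp X) = exp (- X)" by (simp add: adj_exp skew)
  have inP: "p \<in> P" "q \<in> P" using p q cs_sub by blast+
  then have XP: "X \<in> P" by (simp add: X P_closed)
  have UV: "exp X * adj (exp X) = 1" and VU: "adj (exp X) * exp X = 1"
    unfolding adjU by (simp_all add: exp_minus_inverse[of X] exp_minus_inverse[of "- X", simplified])
  have A: "fd_von_neumann_algebra ?A"
    by (rule fd_von_neumann_algebra_conj[OF cs_fd(3) UV VU])
  have AP: "?A \<subseteq> P" using XP cs_sub by (auto simp: P_closed subset_iff)
  have comm: "exp X * b = b * exp X" if "b \<in> Q1" for b
  proof (rule exp_commute)
    have "p * b = b * p" "q * b = b * q" using p q that by (simp_all add: commutant_def)
    then have "p * q * b = b * (p * q)" by (metis mult.assoc)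
    then show "X * b = b * X" by (simp add: X mult_scaleC_left mult_scaleC_right)
  qed
  \<comment> \<open>Elements of \<open>Q1\<close> commute with \<open>exp X\<close>, so conjugation
    fixes them; this keeps \<open>Q1\<close> inside the conjugated algebra.\<close>
  have fix_b: "adj (exp X) * b * exp X = b" if "b \<in> Q1" for b
    using VU by (simp add: mult.assoc flip: comm[OF that]) (simp flip: mult.assoc)
  have QA: "Q1 \<subseteq> ?A"
  proof
    fix b assume b: "b \<in> Q1"
    then show "b \<in> ?A" using cs_sub fix_b[OF b] by (intro image_eqI[of _ _ b]) auto
  qed
  have "cond_exp P \<tau> P1 (cond_exp P \<tau> ?A x) = E x" if x: "x \<in> P" for x
  proof (rule cond_exp_exists(2)[OF cs_fd(1) cs_sub(2)])
    \<comment> \<open>The expectation onto the conjugated algebra is the conjugate of some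
      \<open>y\<close> in \<open>Q0\<close>; it remains to match \<open>E y\<close> with
      \<open>E x\<close>.\<close>
    obtain y where y: "y \<in> Q0" and wy: "cond_exp P \<tau> ?A x = exp (- X) * y * exp X"
      using cond_exp_in[OF A AP x] adjU by auto
    have yP: "y \<in> P" using y cs_sub by blast
    show "cond_exp P \<tau> ?A x \<in> P" using cond_exp_in[OF A AP x] AP by blast
    show "E x \<in> P1" using E_in[OF x] cs_sub by blast
    have key: "\<tau> (a * cond_exp P \<tau> ?A x) = \<tau> (a * E y)" if "a \<in> P1" for a
      unfolding wy by (rule tau_exp_conj[OF that y X])
    \<comment> \<open>A test element \<open>b\<close> of \<open>Q1\<close> lies both in
      \<open>?A\<close> and in \<open>P1\<close>: the first relates its pairing with
      \<open>x\<close> to the expectation onto \<open>?A\<close>, the second relates that to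
      \<open>E y\<close> through \<open>key\<close>.\<close>
    have "E y = E x"
    proof (rule cond_exp_exists(2)[OF cs_fd(2) cs_sub(5) yP E_in[OF x]])
      fix b assume b: "b \<in> Q1"
      have "\<tau> (b * E x) = \<tau> (b * x)" by (rule tau_mult_E[OF b x])
      also have "\<dots> = \<tau> (b * cond_exp P \<tau> ?A x)"
        using tau_mult_cond_exp[OF A AP x, of b] b QA by auto
      also have "\<dots> = \<tau> (b * E y)" using key b cs_sub by blast
      also have "\<dots> = \<tau> (b * y)" by (rule tau_mult_E[OF b yP])
      finally show "\<tau> (b * E x) = \<tau> (b * y)" .
    qed
    then show "\<tau> (a * E x) = \<tau> (a * cond_exp P \<tau> ?A x)" if "a \<in> P1" for a
      using key[OF that] by simp
  qed
  moreover have "{adj (exp X) * y * exp X |y. y \<in> Q0} = ?A" by blast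
  ultimately show ?thesis
    using A AP QA cs_fd cs_sub fd trace by (simp add: commuting_square_def)
qed

end

end

section \<open>The one-parameter family of commuting squares\<close>

theorem theorem4p1:
  fixes Pm P0 Qm Q0 :: "'h::complex_hilbert_space bounded_op set"
    and \<tau> :: "'h bounded_op \<Rightarrow> complex"
    and p\<^sub>0 q\<^sub>0 :: "'h bounded_op"
    and U :: "real \<Rightarrow> 'h bounded_op"
  defines "U \<equiv> \<lambda>t. exp ((\<i> * complex_of_real t) *\<^sub>C (p\<^sub>0 * q\<^sub>0))"
  assumes "commuting_square Pm P0 Qm Q0 \<tau>"
    and "p\<^sub>0 \<in> commutant Qm \<inter> Pm" and "hermitian_op p\<^sub>0" and "p\<^sub>0 \<notin> Qm"
    and "q\<^sub>0 \<in> commutant Qm \<inter> Q0" and "hermitian_op q\<^sub>0" and "q\<^sub>0 \<notin> Qm"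
    and "p\<^sub>0 * q\<^sub>0 - q\<^sub>0 * p\<^sub>0 = 0"
  shows "\<forall>t::real. commuting_square Pm P0 Qm {adj (U t) * y * U t |y. y \<in> Q0} \<tau>"
proof
  fix t :: real
  have pq: "p\<^sub>0 * q\<^sub>0 = q\<^sub>0 * p\<^sub>0" using assms(9) by simp
  interpret traced_algebra P0 \<tau>
    using assms(2) by unfold_locales (auto simp: commuting_square_def)
  \<comment> \<open>The product of two commuting hermitian elements is hermitian, and the imaginary
    scalar changes sign under conjugation.\<close>
  have "adj ((\<i> * complex_of_real t) *\<^sub>C (p\<^sub>0 * q\<^sub>0)) = - ((\<i> * complex_of_real t) *\<^sub>C (p\<^sub>0 * q\<^sub>0))"
    using assms(4,7) pq by (simp add: adj_scaleC adj_mult hermitian_op_def)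
  then show "commuting_square Pm P0 Qm {adj (U t) * y * U t |y. y \<in> Q0} \<tau>"
    unfolding U_def using assms(2,3,6) pq
    by (intro commuting_square_conj[where p = "p\<^sub>0" and q = "q\<^sub>0", OF _ _ _ _ _ _ refl]) auto
qed

end
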